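(* Let $L$ be a slowly varying function at $\infty$ and let $\mu$ be a probability measure on $\mathbb{Z}_{\ge 0}$ with mean $\sum_{i\ge 0} i\mu(i)=1$ and $\mu([n,\infty))\sim L(n)/n$ as $n\to\infty$. Let $\mathcal{T}_n$ (resp. $\mathcal{T}_{\ge n}$) be a $\mathrm{BGW}_\mu$ tree conditioned on having exactly (resp. at least) $n$ vertices, and let $H^*_n$ (resp. $H^*_{\ge n}$) be the height (graph distance to the root) of the vertex with maximal degree in $\mathcal{T}_n$ (resp. $\mathcal{T}_{\ge n}$). Let $\Lambda$ be a slowly varying function with $\Lambda(x)\to\infty$ as $x\to\infty$ such that $H^*_n/\Lambda(n)\to\mathsf{Exp}(1)$ in distribution as $n\to\infty$. Then $$\frac{H^*_{\ge n}}{\Lambda(n)}\ \longrightarrow\ \mathsf{Exp}(1)\quad\text{in distribution as } n\to\infty,$$ where $\mathsf{Exp}(1)$ is an exponential random variable with parameter $1$.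
   Context: A plane tree $\tau$ is a rooted ordered tree; $k_v(\tau)$ denotes the number of children (out-degree) of the vertex $v$. A $\mathrm{BGW}_\mu$ tree is a random plane tree with law $\mathrm{BGW}_\mu(\tau)=\prod_{u\in\tau}\mu(k_u(\tau))$ for every finite plane tree $\tau$. The vertex with maximal degree means the first vertex, in lexicographical (depth-first) order, with maximal out-degree. For $\mathcal{T}_n$, limits are taken along those $n$ for which a $\mathrm{BGW}_\mu$ tree has $n$ vertices with positive probability. *)

theory Defs
  imports "HOL-Probability.Probability" "HOL-Library.Infinite_Set" "HOL-Library.Landau_Symbols"
begin

datatype plane_tree = Node "plane_tree list"

text \<open>Vertices are Ulam--Harris words (the root is \<open>[]\<close>, the \<open>i\<close>-th child of \<open>u\<close> is
  \<open>u @ [i]\<close>, counting from \<open>0\<close>), listed in lexicographical, i.e. depth-first, order.\<close>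

primrec vertices :: "plane_tree \<Rightarrow> nat list list" where
  "vertices (Node ts) =
     [] # concat (map2 (\<lambda>i us. map ((#) i) us) [0..<length ts] (map vertices ts))"

fun subtree_at :: "plane_tree \<Rightarrow> nat list \<Rightarrow> plane_tree" where
  "subtree_at t [] = t"
| "subtree_at (Node ts) (i # u) = subtree_at (ts ! i) u"

definition out_degree :: "plane_tree \<Rightarrow> nat list \<Rightarrow> nat" where
  "out_degree t u = (case subtree_at t u of Node ts \<Rightarrow> length ts)"

definition num_vertices :: "plane_tree \<Rightarrow> nat" where
  "num_vertices t = card (set (vertices t))"

definition max_degree :: "plane_tree \<Rightarrow> nat" where
  "max_degree t = Max (out_degree t ` set (vertices t))"

definition max_degree_vertex :: "plane_tree \<Rightarrow> nat list" where
  "max_degree_vertex t = hd (filter (\<lambda>u. out_degree t u = max_degree t) (vertices t))"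

text \<open>The graph distance of a vertex to the root is the length of its word.\<close>

definition max_degree_height :: "plane_tree \<Rightarrow> nat" where
  "max_degree_height t = length (max_degree_vertex t)"

lemma vertices_sorted: "sorted_wrt (\<lambda>u v. (u, v) \<in> lexord less_than) (vertices t)"
proof (induction t)
  case (Node ts)
  have *: "sorted_wrt (\<lambda>u v. (u, v) \<in> lexord less_than)
             (concat (map2 (\<lambda>i us. map ((#) i) us) [m..<m + length uss] uss))"
    if "\<forall>us\<in>set uss. sorted_wrt (\<lambda>u v. (u, v) \<in> lexord less_than) us"
    for uss :: "nat list list list" and m
    using that
  proof (induction uss arbitrary: m)
    case (Cons us uss)
    have "[m..<m + length (us # uss)] = m # [Suc m..<Suc m + length uss]"
      by (subst upt_rec) simp
    moreover have "sorted_wrt (\<lambda>u v. (u, v) \<in> lexord less_than) (map ((#) m) us)"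
      using Cons.prems by (simp add: sorted_wrt_map)
    moreover have "m < i" if "(i, vs) \<in> set (zip [Suc m..<Suc m + length uss] uss)" for i vs
      using set_zip_leftD[OF that] by auto
    ultimately show ?case
      using Cons.IH[of "Suc m"] Cons.prems by (fastforce simp: sorted_wrt_append)
  qed simp
  have "set (concat (map2 (\<lambda>i us. map ((#) i) us) is uss)) \<subseteq> {u. u \<noteq> []}"
    for "is" :: "nat list" and uss
    by auto
  then show ?case
    using *[of "map vertices ts" 0] Node by (fastforce simp: neq_Nil_conv)
qed

text \<open>The law is carried by finite trees. It has total mass \<open>1\<close> whenever \<open>\<mu>\<close> has mean \<open>1\<close> and
  is not the point mass at \<open>1\<close>.\<close>

definition BGW :: "nat pmf \<Rightarrow> plane_tree measure" where
  "BGW \<mu> = density (count_space UNIV)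
     (\<lambda>t. ennreal (\<Prod>u\<in>set (vertices t). pmf \<mu> (out_degree t u)))"

definition BGW_eq :: "nat pmf \<Rightarrow> nat \<Rightarrow> plane_tree measure" where
  "BGW_eq \<mu> n = uniform_measure (BGW \<mu>) {t. num_vertices t = n}"

definition BGW_ge :: "nat pmf \<Rightarrow> nat \<Rightarrow> plane_tree measure" where
  "BGW_ge \<mu> n = uniform_measure (BGW \<mu>) {t. num_vertices t \<ge> n}"

definition admissible_sizes :: "nat pmf \<Rightarrow> nat set" where
  "admissible_sizes \<mu> = {n. emeasure (BGW \<mu>) {t. num_vertices t = n} > 0}"

text \<open>Limits along the admissible sizes are taken by enumerating this set increasingly. This
  is legitimate because the set is infinite under the hypotheses of interest.\<close>

lemma infinite_admissible_sizes:
  assumes "pmf \<mu> 0 > 0" and "infinite (set_pmf \<mu>)"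
  shows "infinite (admissible_sizes \<mu>)"
proof -
  have "Suc k \<in> admissible_sizes \<mu>" if k: "k \<in> set_pmf \<mu>" for k
  proof -
    define t where "t = Node (replicate k (Node []))"
    have *: "concat (map2 (\<lambda>i us. map ((#) i) us) is (replicate (length is) [[]])) = map (\<lambda>i. [i]) is"
      for "is" :: "nat list"
      by (induction "is") auto
    have vs: "vertices t = [] # map (\<lambda>i. [i]) [0..<k]"
      using *[of "[0..<k]"] by (simp add: t_def)
    have deg: "out_degree t [] = k" "\<And>i. i < k \<Longrightarrow> out_degree t [i] = 0"
      by (auto simp: out_degree_def t_def)
    have "num_vertices t = card (insert [] ((\<lambda>i. [i]) ` {0..<k}))"
      by (simp add: num_vertices_def vs)
    also have "\<dots> = Suc k"
      by (subst card_insert_disjoint) (auto simp: card_image inj_on_def)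
    finally have size: "num_vertices t = Suc k" .
    have "(\<Prod>u\<in>set (vertices t). pmf \<mu> (out_degree t u)) > 0"
      using k assms(1) by (intro prod_pos) (auto simp: vs deg pmf_positive_iff)
    then have "0 < emeasure (BGW \<mu>) {t}"
      by (simp add: BGW_def emeasure_density nn_integral_count_space_indicator[symmetric]
          nn_integral_count_space_finite)
    also have "\<dots> \<le> emeasure (BGW \<mu>) {s. num_vertices s = Suc k}"
      using size by (intro emeasure_mono) (auto simp: BGW_def)
    finally show ?thesis
      by (simp add: admissible_sizes_def)
  qed
  then have "Suc ` set_pmf \<mu> \<subseteq> admissible_sizes \<mu>"
    by auto
  moreover have "infinite (Suc ` set_pmf \<mu>)"
    using assms(2) by (simp add: finite_image_iff)
  ultimately show ?thesis
    using finite_subset by blast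
qed

text \<open>Slow variation at infinity in the sense of Karamata; only the behaviour on some
  neighbourhood of infinity matters.\<close>

definition slowly_varying :: "(real \<Rightarrow> real) \<Rightarrow> bool" where
  "slowly_varying L \<longleftrightarrow>
     (\<exists>a. (\<forall>x\<ge>a. L x > 0) \<and> L \<in> borel_measurable (restrict_space borel {a..})) \<and>
     (\<forall>t>0. ((\<lambda>x. L (t * x) / L x) \<longlongrightarrow> 1) at_top)"

definition Exp_law :: "real \<Rightarrow> real measure" where
  "Exp_law l = density lborel (\<lambda>x. ennreal (exponential_density l x))"

end

theory Submission
  imports Defs "HOL-Real_Asymp.Real_Asymp"
begin

text \<open>
  Let \<open>N\<close> be the number of vertices. Given \<open>N \<ge> n\<close>, the tree is a mixture over \<open>k \<ge> n\<close> of the trees conditioned on \<open>N = k\<close>, in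
  which the height is about \<open>\<Lambda> k\<close> times an exponential variable. Slow variation makes \<open>\<Lambda> k / \<Lambda> n\<close>
  tend to \<open>1\<close> uniformly over \<open>n \<le> k \<le> A * n\<close> (\<open>slowly_varying_uniform\<close>). So the mixture has the same
  limit, provided that the sizes \<open>k > A * n\<close> carry a small proportion of its mass, uniformly in \<open>n\<close>,
  once \<open>A\<close> is large. This reduction is \<open>weak_conv_condition_ge\<close>.

  The work lies in the remaining estimate \<open>BGW_size_tail_ratio\<close>: for every \<open>\<epsilon> > 0\<close> there is an \<open>A\<close> with
  \<open>Q (A * n) \<le> \<epsilon> * Q n\<close> for all large \<open>n\<close>, where \<open>Q n = P(N > n)\<close>. It is proved with generating
  functions, without exact asymptotics. Put \<open>b n = \<mu> {n<..}\<close>, \<open>T y = (\<Sum>n. b n * y ^ n)\<close> and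
  \<open>U s = (\<Sum>n. Q n * s ^ n)\<close>. As \<open>\<mu>\<close> has mean \<open>1\<close>, its generating function is \<open>1 - (1 - y) * T y\<close> with
  \<open>T 1 = 1\<close>, and the branching property says that \<open>y = 1 - (1 - s) * U s\<close>, the generating function of
  \<open>N\<close>, solves \<open>y = s * (1 - (1 - y) * T y)\<close>. Differentiating this equation expresses \<open>U' s\<close>
  through \<open>T y\<close> and \<open>T' y\<close> (\<open>U'_formula\<close>), and as \<open>s \<rightarrow> 1\<close> the quantity \<open>(1 - s)\<^sup>2 * U' s\<close> is within
  constant factors of \<open>tail_scale y = (1 - y)\<^sup>2 * T' y / (1 - T y)\<close>.

  The hypothesis on \<open>\<mu>\<close> enters through \<open>b (2 * n + 1) / b n \<longlonglongrightarrow> 1 / 2\<close>. Replacing \<open>y\<close> by \<open>sqrt y\<close>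
  roughly halves \<open>1 - y\<close>; it then roughly doubles \<open>T' y\<close> and barely changes \<open>1 - T y\<close>
  (\<open>doubling_from_exists\<close>). Hence \<open>tail_scale\<close> decreases geometrically along \<open>y, sqrt y, sqrt (sqrt y), \<dots>\<close>
  while \<open>1 / (1 - s)\<close> grows only geometrically. Since \<open>Q\<close> is decreasing, an elementary Tauberian
  argument shows that \<open>Q n\<close> is comparable to \<open>tail_scale y\<close> when \<open>1 - s\<close> is of order \<open>1 / n\<close>
  (\<open>scale_le_tail\<close>, \<open>tail_le_scale\<close>), and the estimate follows.
\<close>

section \<open>Power series with nonnegative coefficients\<close>

definition gf :: "(nat \<Rightarrow> real) \<Rightarrow> real \<Rightarrow> real" where
  "gf c y = (\<Sum>n. c n * y ^ n)"

lemma summable_bounded_gf: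
  fixes c :: "nat \<Rightarrow> real"
  assumes "\<And>n. \<bar>c n\<bar> \<le> K" "norm y < 1"
  shows "summable (\<lambda>n. c n * y ^ n)"
proof (rule summable_comparison_test')
  show "summable (\<lambda>n. K * norm y ^ n)"
    using assms(2) by (intro summable_mult summable_geometric) auto
  show "norm (c n * y ^ n) \<le> K * norm y ^ n" for n
    using assms(1)[of n] by (simp add: abs_mult power_abs mult_right_mono)
qed

lemma gf_DERIV:
  assumes "\<And>z. norm z < 1 \<Longrightarrow> summable (\<lambda>n. c n * z ^ n)" "norm y < 1"
  shows "(gf c has_real_derivative gf (diffs c) y) (at y)"
  unfolding gf_def [abs_def] using termdiffs_strong'[OF assms] .

lemma summable_diffs_gf:
  fixes c :: "nat \<Rightarrow> real"
  assumes "\<And>z. norm z < 1 \<Longrightarrow> summable (\<lambda>n. c n * z ^ n)" "norm y < 1"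
  shows "summable (\<lambda>n. diffs c n * y ^ n)"
  using termdiff_converges[OF assms(2,1)] .

lemma gf_mono:
  assumes "\<And>n. 0 \<le> c n" "0 \<le> y" "y \<le> z" "summable (\<lambda>n. c n * z ^ n)"
  shows "gf c y \<le> gf c z"
proof -
  have le: "c n * y ^ n \<le> c n * z ^ n" for n
    using assms by (intro mult_left_mono power_mono) auto
  then have "summable (\<lambda>n. c n * y ^ n)"
    using assms by (intro summable_comparison_test'[OF assms(4)]) auto
  with le assms(4) show ?thesis
    unfolding gf_def by (intro suminf_le) auto
qed

lemma gf_ge_partial_sum:
  assumes "\<And>n. 0 \<le> c n" "0 \<le> y" "summable (\<lambda>n. c n * y ^ n)"
  shows "(\<Sum>n<N. c n * y ^ n) \<le> gf c y"
  unfolding gf_def using assms by (intro sum_le_suminf) auto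

text \<open>One direction of Abel's theorem, for nonnegative coefficients: near \<open>1\<close> the
  series dominates each of its partial sums, which are continuous.\<close>

lemma gf_eventually_ge:
  assumes c: "\<And>n. 0 \<le> c n" and sm: "\<And>z. norm z < 1 \<Longrightarrow> summable (\<lambda>n. c n * z ^ n)"
    and K: "K < (\<Sum>n<N. c n)"
  shows "eventually (\<lambda>y. K \<le> gf c y) (at_left 1)"
proof -
  have "((\<lambda>y. \<Sum>n<N. c n * y ^ n) \<longlongrightarrow> (\<Sum>n<N. c n * 1 ^ n)) (at_left 1)"
    by (intro tendsto_intros)
  then have "eventually (\<lambda>y. K < (\<Sum>n<N. c n * y ^ n)) (at_left 1)"
    using K by (intro order_tendstoD) auto
  moreover have "eventually (\<lambda>y::real. 0 < y \<and> y < 1) (at_left 1)"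
    by (auto simp: eventually_at_left_field intro!: exI[of _ 0])
  ultimately show ?thesis
  proof eventually_elim
    case (elim y)
    then show ?case
      using gf_ge_partial_sum[of c y N] c sm[of y] by auto
  qed
qed

text \<open>A coefficientwise inequality that holds from some index on passes to the sums up to a constant
  that does not depend on the argument; the constant is harmless when the series diverge at \<open>1\<close>.\<close>

lemma gf_le_eventual_coefficients:
  assumes c: "\<And>n. 0 \<le> c n" and d: "\<And>n. 0 \<le> d n"
    and le: "\<And>n. n \<ge> M \<Longrightarrow> d n \<le> K * c n" and K: "0 \<le> K" and y: "0 \<le> y" "y < 1"
    and sc: "summable (\<lambda>n. c n * y ^ n)" and sd: "summable (\<lambda>n. d n * y ^ n)"
  shows "gf d y \<le> K * gf c y + (\<Sum>n<M. d n)"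
proof -
  have "(\<Sum>n. d (n + M) * y ^ (n + M)) \<le> (\<Sum>n. K * (c (n + M) * y ^ (n + M)))"
  proof (intro suminf_le)
    show "summable (\<lambda>n. d (n + M) * y ^ (n + M))"
      using sd by (rule summable_ignore_initial_segment)
    show "summable (\<lambda>n. K * (c (n + M) * y ^ (n + M)))"
      using sc by (intro summable_mult summable_ignore_initial_segment)
    show "d (n + M) * y ^ (n + M) \<le> K * (c (n + M) * y ^ (n + M))" for n
      using mult_right_mono[OF le[of "n + M"], of "y ^ (n + M)"] y by (simp add: mult.assoc)
  qed
  also have "\<dots> = K * (\<Sum>n. c (n + M) * y ^ (n + M))"
    using sc by (intro suminf_mult summable_ignore_initial_segment)
  also have "\<dots> \<le> K * gf c y"
    unfolding gf_def suminf_split_initial_segment[OF sc, of M]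
    using K c y by (intro mult_left_mono) (auto intro!: sum_nonneg)
  finally have "(\<Sum>n. d (n + M) * y ^ (n + M)) \<le> K * gf c y" .
  moreover have "(\<Sum>n<M. d n * y ^ n) \<le> (\<Sum>n<M. d n)"
    using d y by (intro sum_mono mult_left_le power_le_one) auto
  ultimately show ?thesis
    unfolding gf_def suminf_split_initial_segment[OF sd, of M] by linarith
qed

lemma suminf_even_odd:
  fixes f :: "nat \<Rightarrow> real"
  assumes "summable f"
  shows "(\<lambda>m. f (2 * m) + f (2 * m + 1)) sums suminf f"
  using sums_group[OF summable_sums[OF assms], of 2]
  by (simp add: numeral_2_eq_2 mult.commute)

text \<open>Summation by parts. It is applied both to the offspring law and to the law of the tree size.\<close>

lemma gf_eq_tail_gf:
  fixes p :: "nat \<Rightarrow> real"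
  assumes p: "\<And>n. 0 \<le> p n" and sums: "p sums 1" and y: "0 \<le> y" "y < 1"
  shows "gf p y = 1 - (1 - y) * gf (\<lambda>n. 1 - (\<Sum>k\<le>n. p k)) y"
proof -
  define q where "q n = 1 - (\<Sum>k\<le>n. p k)" for n
  have le1: "(\<Sum>k\<le>n. p k) \<le> 1" for n
    using sums p sum_le_suminf[of p "{..n}"] by (auto simp: sums_iff)
  have q01: "0 \<le> q n" "q n \<le> 1" for n
    using le1[of n] p by (auto simp: q_def sum_nonneg)
  have p1: "p n \<le> 1" for n
    using le1[of n] member_le_sum[of n "{..n}" p] p by auto
  have sq: "summable (\<lambda>n. q n * y ^ n)" and sp: "summable (\<lambda>n. p n * y ^ n)"
    using q01 p p1 y by (auto intro!: summable_bounded_gf[of _ 1])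
  have sq': "summable (\<lambda>n. q (Suc n) * y ^ Suc n)" and sp': "summable (\<lambda>n. p (Suc n) * y ^ Suc n)"
    using sq sp by (subst summable_Suc_iff, simp)+
  have "y * gf q y = (\<Sum>n. q n * y ^ Suc n)"
    unfolding gf_def by (subst suminf_mult[OF sq, symmetric]) (simp add: mult_ac)
  also have "\<dots> = (\<Sum>n. q (Suc n) * y ^ Suc n + p (Suc n) * y ^ Suc n)"
    by (intro suminf_cong) (simp add: q_def algebra_simps)
  also have "\<dots> = (\<Sum>n. q (Suc n) * y ^ Suc n) + (\<Sum>n. p (Suc n) * y ^ Suc n)"
    by (rule suminf_add[symmetric, OF sq' sp'])
  also have "\<dots> = (gf q y - q 0) + (gf p y - p 0)"
    unfolding gf_def suminf_split_head[OF sq] suminf_split_head[OF sp] by simp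
  also have "q 0 = 1 - p 0" by (simp add: q_def)
  finally have "gf p y = 1 - (1 - y) * gf q y" by (simp add: algebra_simps)
  then show ?thesis by (simp add: q_def[abs_def])
qed

section \<open>Mean-one laws whose tail halves when its argument doubles\<close>

text \<open>The sequence \<open>b\<close> plays the role of the tail \<open>P(\<xi> > n)\<close> of a nonnegative integer variable of mean \<open>1\<close>.
  The index \<open>2 * n + 1\<close> is the one for which \<open>\<xi> > n\<close> turns into \<open>\<xi> > 2 * n + 1\<close>, that is, \<open>\<xi> \<ge> n + 1\<close>
  into \<open>\<xi> \<ge> 2 * (n + 1)\<close>.\<close>

locale halving_tail =
  fixes b :: "nat \<Rightarrow> real"
  assumes b_dec: "\<And>m n. m \<le> n \<Longrightarrow> b n \<le> b m"
    and b_pos: "\<And>n. 0 < b n"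
    and b_sums: "b sums 1"
    and b_halving: "(\<lambda>n. b (2 * n + 1) / b n) \<longlonglongrightarrow> 1 / 2"
begin

abbreviation T where "T \<equiv> gf b"
abbreviation T' where "T' \<equiv> gf (diffs b)"

lemma b_summable: "norm y < 1 \<Longrightarrow> summable (\<lambda>n. b n * y ^ n)"
  using b_dec[of 0] b_pos by (intro summable_bounded_gf[of _ "b 0"]) (auto simp: less_imp_le)

lemma diffs_pos: "0 < diffs b n"
  using b_pos by (simp add: diffs_def)

lemma T'_summable: "norm y < 1 \<Longrightarrow> summable (\<lambda>n. diffs b n * y ^ n)"
  using summable_diffs_gf[OF b_summable] by blast

lemma T_DERIV: "norm y < 1 \<Longrightarrow> (T has_real_derivative T' y) (at y)"
  using gf_DERIV[OF b_summable] by blast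

lemma T_mono: "0 \<le> y \<Longrightarrow> y \<le> z \<Longrightarrow> z < 1 \<Longrightarrow> T y \<le> T z"
  using b_pos by (intro gf_mono b_summable) (auto intro: less_imp_le)

lemma T_nonneg: "0 \<le> y \<Longrightarrow> y < 1 \<Longrightarrow> 0 \<le> T y"
  using b_pos unfolding gf_def by (intro suminf_nonneg b_summable) (auto simp: less_imp_le)

lemma T'_mono: "0 \<le> y \<Longrightarrow> y \<le> z \<Longrightarrow> z < 1 \<Longrightarrow> T' y \<le> T' z"
  using diffs_pos by (intro gf_mono T'_summable) (auto intro: less_imp_le)

lemma T'_pos: "0 \<le> y \<Longrightarrow> y < 1 \<Longrightarrow> 0 < T' y"
  using gf_ge_partial_sum[of "diffs b" y 1, OF less_imp_le[OF diffs_pos]] diffs_pos[of 0] T'_summable[of y]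
  by auto

lemma T_le_1:
  assumes "0 \<le> y" "y < 1"
  shows "T y \<le> 1"
proof -
  have "T y \<le> suminf b"
    unfolding gf_def using b_pos b_sums assms
    by (intro suminf_le b_summable) (auto simp: sums_iff less_imp_le intro!: mult_left_le power_le_one)
  then show ?thesis using b_sums by (simp add: sums_iff)
qed

lemma T_diff_ge:
  assumes "0 \<le> y" "y \<le> z" "z < 1"
  shows "(z - y) * T' y \<le> T z - T y"
proof (cases "y = z")
  case False
  then obtain w where "y < w" "w < z" "T z - T y = (z - y) * T' w"
    using MVT2[of y z T T'] assms T_DERIV by auto
  then show ?thesis
    using T'_mono[of y w] assms by (auto intro!: mult_left_mono)
qed simp

text \<open>Convexity of \<open>T\<close> on \<open>{y..<1}\<close>; at the end point only the bound \<open>T \<le> 1\<close> is used.\<close>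

lemma T'_le_difference_quotient:
  assumes "0 \<le> y" "y < 1"
  shows "(1 - y) * T' y \<le> 1 - T y"
proof -
  have "eventually (\<lambda>z. y < z \<and> z < 1) (at_left 1)"
    using assms by (auto simp: eventually_at_left_field)
  then have "eventually (\<lambda>z. (z - y) * T' y \<le> 1 - T y) (at_left 1)"
  proof eventually_elim
    case (elim z)
    then show ?case
      using T_diff_ge[of y z] T_le_1[of z] assms by linarith
  qed
  moreover have "((\<lambda>z. (z - y) * T' y) \<longlongrightarrow> (1 - y) * T' y) (at_left 1)"
    by (intro tendsto_intros)
  ultimately show ?thesis
    by (intro tendsto_upperbound) auto
qed

lemma T_less_1:
  assumes "0 \<le> y" "y < 1"
  shows "T y < 1"
proof -
  have "0 < (1 - y) * T' y" using T'_pos[OF assms] assms by simp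
  with T'_le_difference_quotient[OF assms] show ?thesis by linarith
qed

lemma T_tendsto_1: "(T \<longlongrightarrow> 1) (at_left 1)"
proof (rule order_tendstoI)
  fix a :: real assume "a < 1"
  define a' where "a' = (a + 1) / 2"
  have a': "a < a'" "a' < 1" using \<open>a < 1\<close> by (auto simp: a'_def)
  have "eventually (\<lambda>N. a' < (\<Sum>n<N. b n)) sequentially"
    using b_sums a' unfolding sums_def by (intro order_tendstoD) auto
  then obtain N where "a' < (\<Sum>n<N. b n)"
    by (auto simp: eventually_sequentially)
  then have "eventually (\<lambda>y. a' \<le> T y) (at_left 1)"
    using b_pos b_summable by (intro gf_eventually_ge) (auto simp: less_imp_le)
  then show "eventually (\<lambda>y. a < T y) (at_left 1)"
    by eventually_elim (use a' in auto)
next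
  fix a :: real assume "1 < a"
  have "eventually (\<lambda>y::real. 0 < y \<and> y < 1) (at_left 1)"
    by (auto simp: eventually_at_left_field intro!: exI[of _ 0])
  then show "eventually (\<lambda>y. T y < a) (at_left 1)"
  proof eventually_elim
    case (elim y)
    then show ?case using T_le_1[of y] \<open>1 < a\<close> by auto
  qed
qed

text \<open>The two inequalities bound the blocks \<open>{2 * m, 2 * m + 1}\<close> and \<open>{2 * m + 1, 2 * m + 2}\<close> of
  \<open>\<Sum>n. n * b n\<close>: by monotonicity, a block containing \<open>2 * m + 1\<close> as its last (first) index has a
  sum at least \<open>(4 * m + 1) * b (2 * m + 1)\<close> (at most \<open>(4 * m + 3) * b (2 * m + 1)\<close>). Both are close to
  \<open>2 * (m * b m)\<close>; the constants \<open>1.95\<close> and \<open>2.05\<close> leave room for later losses.\<close>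

lemma halving_bounds:
  obtains M where "M \<ge> 1" "\<And>m. m \<ge> M \<Longrightarrow> 195 / 100 * (real m * b m) \<le> (4 * real m + 1) * b (2 * m + 1)"
    "\<And>m. m \<ge> M \<Longrightarrow> (4 * real m + 3) * b (2 * m + 1) \<le> 205 / 100 * (real m * b m)"
proof -
  have 1: "(\<lambda>m. (4 * real m + 1) / m * (b (2 * m + 1) / b m)) \<longlonglongrightarrow> 4 * (1 / 2)"
    by (intro tendsto_mult b_halving) real_asymp
  have 2: "(\<lambda>m. (4 * real m + 3) / m * (b (2 * m + 1) / b m)) \<longlonglongrightarrow> 4 * (1 / 2)"
    by (intro tendsto_mult b_halving) real_asymp
  have "eventually (\<lambda>m. 195 / 100 < (4 * real m + 1) / m * (b (2 * m + 1) / b m)) sequentially"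
    using 1 by (rule order_tendstoD) simp
  moreover have "eventually (\<lambda>m. (4 * real m + 3) / m * (b (2 * m + 1) / b m) < 205 / 100) sequentially"
    using 2 by (rule order_tendstoD) simp
  ultimately have "eventually (\<lambda>m. 195 / 100 * (real m * b m) \<le> (4 * real m + 1) * b (2 * m + 1) \<and>
     (4 * real m + 3) * b (2 * m + 1) \<le> 205 / 100 * (real m * b m)) sequentially"
    using eventually_gt_at_top[of 0]
  proof eventually_elim
    case (elim m)
    then show ?case using b_pos[of m] by (simp add: field_simps)
  qed
  then obtain M where "\<forall>m\<ge>M. 195 / 100 * (real m * b m) \<le> (4 * real m + 1) * b (2 * m + 1) \<and>
     (4 * real m + 3) * b (2 * m + 1) \<le> 205 / 100 * (real m * b m)"
    unfolding eventually_sequentially by (rule exE)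
  note M = this[rule_format]
  show ?thesis
  proof (rule that[of "max M 1"])
    show "1 \<le> max M 1" by simp
  next
    fix m assume "max M 1 \<le> m"
    then show "195 / 100 * (real m * b m) \<le> (4 * real m + 1) * b (2 * m + 1)"
      "(4 * real m + 3) * b (2 * m + 1) \<le> 205 / 100 * (real m * b m)"
      using M[of m] by auto
  qed
qed

text \<open>Infinite variance. A tail sum of \<open>\<Sum>n. n * b n\<close> starting at a large \<open>M\<close> would dominate the one
  starting at \<open>2 * M\<close>, which by the block bounds is at least \<open>1.95\<close> times the tail sum from \<open>M\<close>.\<close>

lemma not_summable_weighted_tail: "\<not> summable (\<lambda>n. real n * b n)"
proof
  assume sm: "summable (\<lambda>n. real n * b n)"
  obtain M where M: "M \<ge> 1" "\<And>m. m \<ge> M \<Longrightarrow> 195 / 100 * (real m * b m) \<le> (4 * real m + 1) * b (2 * m + 1)"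
    using halving_bounds by metis
  define c where "c n = real n * b n" for n
  have c: "0 \<le> c n" for n using b_pos[of n] by (simp add: c_def)
  have sc: "summable (\<lambda>n. c (n + k))" for k
    using summable_ignore_initial_segment[OF sm] by (simp add: c_def)
  have pair: "(\<lambda>m. c (2 * m + 2 * M) + c (2 * m + 1 + 2 * M)) sums (\<Sum>n. c (n + 2 * M))"
    using suminf_even_odd[OF sc[of "2 * M"]] by simp
  have ge: "195 / 100 * c (m + M) \<le> c (2 * m + 2 * M) + c (2 * m + 1 + 2 * M)" for m
  proof -
    have "195 / 100 * c (m + M) \<le> (4 * real (m + M) + 1) * b (2 * (m + M) + 1)"
      using M(2)[of "m + M"] by (simp add: c_def)
    also have "\<dots> = 2 * real (m + M) * b (2 * (m + M) + 1) + (2 * real (m + M) + 1) * b (2 * (m + M) + 1)"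
      by (simp add: algebra_simps)
    also have "2 * real (m + M) * b (2 * (m + M) + 1) \<le> 2 * real (m + M) * b (2 * (m + M))"
      using b_dec by (intro mult_left_mono) auto
    finally show ?thesis by (simp add: c_def algebra_simps)
  qed
  have "195 / 100 * (\<Sum>n. c (n + M)) = (\<Sum>n. 195 / 100 * c (n + M))"
    using sc by (intro suminf_mult[symmetric]) auto
  also have "\<dots> \<le> (\<Sum>n. c (n + 2 * M))"
    unfolding sums_unique[OF pair] using ge sc pair by (intro suminf_le summable_mult) (auto simp: sums_iff)
  also have "\<dots> \<le> (\<Sum>n. c (n + M))"
    using suminf_split_initial_segment[OF sc[of M], of M] c
    by (simp add: add.assoc mult_2 sum_nonneg)
  finally have "(\<Sum>n. c (n + M)) \<le> 0" by simp
  moreover have "c M \<le> (\<Sum>n. c (n + M))"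
    using sum_le_suminf[OF sc[of M], of "{0}"] c by simp
  ultimately show False
    using M(1) mult_pos_pos[of "real M" "b M"] b_pos[of M] unfolding c_def by linarith
qed

definition P where "P = gf (\<lambda>n. real n * b n)"

lemma P_summable: "norm y < 1 \<Longrightarrow> summable (\<lambda>n. real n * b n * y ^ n)"
proof -
  assume y: "norm y < 1"
  have "summable (\<lambda>n. diffs b n * y ^ n * y)"
    using T'_summable[OF y] by (intro summable_mult2)
  then have "summable (\<lambda>n. real (Suc n) * b (Suc n) * y ^ Suc n)"
    by (simp add: diffs_def mult_ac)
  then show ?thesis by (subst (asm) summable_Suc_iff)
qed

lemma P_eq: "norm y < 1 \<Longrightarrow> P y = y * T' y"
proof -
  assume y: "norm y < 1"
  have "P y = (\<Sum>n. real (Suc n) * b (Suc n) * y ^ Suc n)"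
    unfolding P_def gf_def by (subst suminf_split_head[OF P_summable[OF y]]) simp
  also have "\<dots> = (\<Sum>n. y * (diffs b n * y ^ n))"
    by (simp add: diffs_def mult_ac)
  also have "\<dots> = y * T' y"
    unfolding gf_def using T'_summable[OF y] by (rule suminf_mult)
  finally show ?thesis .
qed

lemma P_at_top: "filterlim P at_top (at_left 1)"
  unfolding filterlim_at_top
proof
  fix K :: real
  have c: "0 \<le> real n * b n" for n using b_pos[of n] by simp
  have "\<exists>N. K < (\<Sum>n<N. real n * b n)"
  proof (rule ccontr)
    assume "\<not> ?thesis"
    then have "summable (\<lambda>n. real n * b n)"
      using c by (intro summableI_nonneg_bounded[of _ K]) (auto simp: not_less)
    then show False using not_summable_weighted_tail by simp
  qed
  then obtain N where "K < (\<Sum>n<N. real n * b n)" ..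
  then show "eventually (\<lambda>y. K \<le> P y) (at_left 1)"
    unfolding P_def using c P_summable by (intro gf_eventually_ge)
qed

text \<open>Grouping the coefficients of \<open>P\<close> in pairs compares \<open>P y\<close> with \<open>P (y\<^sup>2)\<close>, since \<open>y ^ (2 * m) = (y\<^sup>2) ^ m\<close>.
  The pairs start at even indices for the lower bound and at odd indices for the upper one, so that
  only monotonicity of \<open>b\<close> is used to compare neighbours.\<close>

lemma P_doubling_bounds:
  obtains C where "\<And>y. 0 \<le> y \<Longrightarrow> y < 1 \<Longrightarrow> y * P y \<le> 205 / 100 * y\<^sup>2 * P (y\<^sup>2) + C"
    "\<And>y. 0 \<le> y \<Longrightarrow> y < 1 \<Longrightarrow> 195 / 100 * y\<^sup>2 * P (y\<^sup>2) \<le> y * P y + C"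
proof -
  obtain M where M: "M \<ge> 1" "\<And>m. m \<ge> M \<Longrightarrow> 195 / 100 * (real m * b m) \<le> (4 * real m + 1) * b (2 * m + 1)"
    "\<And>m. m \<ge> M \<Longrightarrow> (4 * real m + 3) * b (2 * m + 1) \<le> 205 / 100 * (real m * b m)"
    using halving_bounds by metis
  define c where "c n = real n * b n" for n
  define d1 where "d1 m = (4 * real m + 1) * b (2 * m + 1)" for m
  define d2 where "d2 m = (4 * real m + 3) * b (2 * m + 1)" for m
  have c: "0 \<le> c n" "0 \<le> d1 n" "0 \<le> d2 n" for n
    using b_pos[of n] b_pos[of "2 * n + 1"] by (auto simp: c_def d1_def d2_def)
  have Mcd: "c m \<le> 100 / 195 * d1 m" "d2 m \<le> 205 / 100 * c m" if "m \<ge> M" for m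
    using M(2)[OF that] M(3)[OF that] unfolding c_def d1_def d2_def by linarith+
  define C where "C = (\<Sum>n<M. d2 n) + 195 / 100 * (\<Sum>n<M. c n)"
  have C: "(\<Sum>n<M. d2 n) \<le> C" "195 / 100 * (\<Sum>n<M. c n) \<le> C"
    using c by (auto simp: C_def sum_nonneg)
  have sd2: "summable (\<lambda>n. d2 n * z ^ n)" if z: "0 \<le> z" "z < 1" for z
  proof (rule summable_comparison_test_ev)
    show "summable (\<lambda>n. 205 / 100 * (c n * z ^ n))"
      using P_summable[of z] z by (intro summable_mult) (auto simp: c_def)
    show "eventually (\<lambda>n. norm (d2 n * z ^ n) \<le> 205 / 100 * (c n * z ^ n)) sequentially"
      using eventually_ge_at_top[of M]
    proof eventually_elim
      case (elim n)
      then show ?case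
        using M(3)[of n] c[of n] z mult_right_mono[of "d2 n" "205/100 * c n" "z ^ n"]
        by (simp add: d2_def c_def)
    qed
  qed
  have sd1: "summable (\<lambda>n. d1 n * z ^ n)" if z: "0 \<le> z" "z < 1" for z
    using c z by (intro summable_comparison_test'[OF sd2[OF z], of 0])
      (auto simp: d1_def d2_def intro!: mult_right_mono b_pos[THEN less_imp_le])
  show ?thesis
  proof (rule that[of C])
    fix y :: real assume y: "0 \<le> y" "y < 1"
    then have y2: "0 \<le> y\<^sup>2" "y\<^sup>2 < 1" by (auto simp: power_less_one_iff abs_square_less_1)
    have sc: "summable (\<lambda>n. c n * y ^ n)"
      using P_summable[of y] y by (simp add: c_def)
    have Py: "P y = gf c y" "P (y\<^sup>2) = gf c (y\<^sup>2)" by (simp_all add: P_def c_def[abs_def])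
    have sc2: "summable (\<lambda>n. c n * (y\<^sup>2) ^ n)"
      using P_summable[of "y\<^sup>2"] y2 by (simp add: c_def)
    have "(\<lambda>m. c (2*m) * y^(2*m) + c (2*m+1) * y^(2*m+1)) sums P y"
      using suminf_even_odd[OF sc] unfolding Py gf_def by simp
    then have ev: "(\<lambda>m. y * (c (2*m) * y^(2*m) + c (2*m+1) * y^(2*m+1))) sums (y * P y)"
      by (rule sums_mult)
    have "summable (\<lambda>n. c (Suc n) * y ^ Suc n)" using sc by (subst summable_Suc_iff)
    then have "(\<lambda>m. c (Suc (2*m)) * y^(Suc (2*m)) + c (Suc (2*m+1)) * y^Suc (2*m+1))
         sums (\<Sum>n. c (Suc n) * y ^ Suc n)"
      by (rule suminf_even_odd)
    also have "(\<Sum>n. c (Suc n) * y ^ Suc n) = P y"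
      unfolding Py gf_def using suminf_split_head[OF sc] by (simp add: c_def)
    finally have od: "(\<lambda>m. y * (c (2*m+1) * y^(2*m+1) + c (2*m+2) * y^(2*m+2))) sums (y * P y)"
      by (intro sums_mult) simp
    have s1: "(\<lambda>m. y\<^sup>2 * (d1 m * (y\<^sup>2)^m)) sums (y\<^sup>2 * gf d1 (y\<^sup>2))"
      unfolding gf_def using sd1[OF y2] by (intro sums_mult summable_sums)
    have s2: "(\<lambda>m. y\<^sup>2 * (d2 m * (y\<^sup>2)^m)) sums (y\<^sup>2 * gf d2 (y\<^sup>2))"
      unfolding gf_def using sd2[OF y2] by (intro sums_mult summable_sums)
    have pw: "y ^ (2*m+1) = y * (y\<^sup>2)^m" "y ^ (2*m) = (y\<^sup>2)^m" "y ^ (2*m+2) = y\<^sup>2 * (y\<^sup>2)^m" for m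
      by (simp_all add: power_mult power_add power2_eq_square)
    have up: "y * P y \<le> y\<^sup>2 * gf d2 (y\<^sup>2)"
    proof (rule sums_le[OF _ od s2])
      fix m
      have "c (2*m+2) * y \<le> c (2*m+2)"
        using c(1)[of "2*m+2"] y by (intro mult_left_le) auto
      also have "\<dots> \<le> (2 * real m + 2) * b (2*m+1)"
        using b_dec[of "2*m+1" "2*m+2"] unfolding c_def
        by (intro mult_mono) (auto simp: less_imp_le[OF b_pos])
      finally have "c (2*m+2) * y \<le> (2 * real m + 2) * b (2*m+1)" .
      then have "c (2*m+1) + c (2*m+2) * y \<le> d2 m"
        by (simp add: c_def d2_def algebra_simps)
      then have "y\<^sup>2 * (y\<^sup>2)^m * (c (2*m+1) + c (2*m+2) * y) \<le> y\<^sup>2 * (y\<^sup>2)^m * d2 m"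
        by (intro mult_left_mono) auto
      then show "y * (c (2*m+1) * y^(2*m+1) + c (2*m+2) * y^(2*m+2)) \<le> y\<^sup>2 * (d2 m * (y\<^sup>2)^m)"
        unfolding pw by (simp add: algebra_simps power2_eq_square)
    qed
    have lo: "y\<^sup>2 * gf d1 (y\<^sup>2) \<le> y * P y"
    proof (rule sums_le[OF _ s1 ev])
      fix m
      have "y * (2 * real m * b (2*m+1)) \<le> 2 * real m * b (2*m+1)"
        using b_pos[of "2*m+1"] y by (intro mult_left_le_one_le) auto
      also have "\<dots> \<le> c (2*m)"
        using b_dec[of "2*m" "2*m+1"] unfolding c_def by (auto intro!: mult_left_mono)
      finally have "y * (2 * real m * b (2*m+1)) \<le> c (2*m)" .
      then have "y * d1 m \<le> c (2*m) + y * c (2*m+1)"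
        by (simp add: c_def d1_def algebra_simps)
      then have "y * (y\<^sup>2)^m * (y * d1 m) \<le> y * (y\<^sup>2)^m * (c (2*m) + y * c (2*m+1))"
        using y by (intro mult_left_mono) auto
      then show "y\<^sup>2 * (d1 m * (y\<^sup>2)^m) \<le> y * (c (2*m) * y^(2*m) + c (2*m+1) * y^(2*m+1))"
        unfolding pw by (simp add: algebra_simps power2_eq_square)
    qed
    have "gf d2 (y\<^sup>2) \<le> 205 / 100 * gf c (y\<^sup>2) + (\<Sum>n<M. d2 n)"
      using Mcd(2) c y2 sc2 sd2[OF y2] by (intro gf_le_eventual_coefficients) auto
    then have "gf d2 (y\<^sup>2) \<le> 205 / 100 * P (y\<^sup>2) + C"
      using C Py by linarith
    from mult_left_mono[OF this, of "y\<^sup>2"] have "y\<^sup>2 * gf d2 (y\<^sup>2) \<le> y\<^sup>2 * (205 / 100 * P (y\<^sup>2)) + y\<^sup>2 * C"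
      using y2 by (simp add: distrib_left)
    also have "y\<^sup>2 * C \<le> C"
      using y2 C(1) c by (intro mult_left_le_one_le) (auto intro!: order.trans[OF _ C(1)] sum_nonneg)
    finally show "y * P y \<le> 205 / 100 * y\<^sup>2 * P (y\<^sup>2) + C"
      using up by (simp add: mult_ac)
    have "gf c (y\<^sup>2) \<le> 100 / 195 * gf d1 (y\<^sup>2) + (\<Sum>n<M. c n)"
      using Mcd(1) c y2 sc2 sd1[OF y2] by (intro gf_le_eventual_coefficients) auto
    then have "195 / 100 * P (y\<^sup>2) \<le> gf d1 (y\<^sup>2) + C"
      using C Py by linarith
    from mult_left_mono[OF this, of "y\<^sup>2"] have "y\<^sup>2 * (195 / 100 * P (y\<^sup>2)) \<le> y\<^sup>2 * gf d1 (y\<^sup>2) + y\<^sup>2 * C"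
      using y2 by (simp add: distrib_left)
    moreover have "y\<^sup>2 * C \<le> C"
      using y2 C(1) c by (intro mult_left_le_one_le) (auto intro!: order.trans[OF _ C(1)] sum_nonneg)
    ultimately show "195 / 100 * y\<^sup>2 * P (y\<^sup>2) \<le> y * P y + C"
      using lo by (simp add: mult_ac)
  qed
qed

text \<open>Up to constants this is the probability that the tree has more than \<open>1 / (1 - s)\<close> vertices, for the
  \<open>s\<close> at which the generating function of the tree size takes the value \<open>y\<close>.\<close>

definition tail_scale where "tail_scale y = (1 - y)\<^sup>2 * T' y / (1 - T y)"

text \<open>\<open>P y\<close> and \<open>T' y\<close> differ by the factor \<open>y\<close>, which is close to \<open>1\<close>, and the additive constant is
  negligible because \<open>P\<close> is unbounded.\<close>

lemma T'_doubling:
  "eventually (\<lambda>y. 19 / 10 * T' (y\<^sup>2) \<le> T' y \<and> T' y \<le> 21 / 10 * T' (y\<^sup>2)) (at_left 1)"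
proof -
  obtain C where C: "\<And>y. 0 \<le> y \<Longrightarrow> y < 1 \<Longrightarrow> y * P y \<le> 205 / 100 * y\<^sup>2 * P (y\<^sup>2) + C"
    "\<And>y. 0 \<le> y \<Longrightarrow> y < 1 \<Longrightarrow> 195 / 100 * y\<^sup>2 * P (y\<^sup>2) \<le> y * P y + C"
    using P_doubling_bounds by metis
  have sq: "filterlim (\<lambda>y::real. y\<^sup>2) (at_left 1) (at_left 1)"
    by real_asymp
  have "eventually (\<lambda>y. 100 * C \<le> P (y\<^sup>2)) (at_left 1)"
    using filterlim_compose[OF P_at_top sq] unfolding filterlim_at_top by blast
  moreover have "eventually (\<lambda>y::real. 99 / 100 < y \<and> y < 1) (at_left 1)"
    by (auto simp: eventually_at_left_field intro!: exI[of _ "99/100"])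
  ultimately show ?thesis
  proof eventually_elim
    case (elim y)
    then have y: "0 \<le> y" "y < 1" "99/100 < y" by auto
    have "98 / 100 \<le> (99 / 100 :: real)\<^sup>2" by (simp add: power2_eq_square)
    also have "\<dots> \<le> y\<^sup>2" using y by (intro power_mono) auto
    finally have y2: "0 \<le> y\<^sup>2" "y\<^sup>2 < 1" "98/100 \<le> y\<^sup>2"
      using y by (simp_all add: abs_square_less_1)
    have P: "P y = y * T' y" "P (y\<^sup>2) = y\<^sup>2 * T' (y\<^sup>2)"
      using y y2 by (auto intro!: P_eq)
    have t: "0 < T' y" "0 < T' (y\<^sup>2)" using y y2 by (auto intro!: T'_pos)
    have "y\<^sup>2 * T' y \<le> 205 / 100 * y\<^sup>2 * (y\<^sup>2 * T' (y\<^sup>2)) + C"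
      using C(1)[OF y(1,2)] unfolding P by (simp add: power2_eq_square mult_ac)
    also have "\<dots> \<le> 205 / 100 * y\<^sup>2 * T' (y\<^sup>2) + 1 / 98 * (y\<^sup>2 * T' (y\<^sup>2))"
    proof (rule add_mono)
      show "205 / 100 * y\<^sup>2 * (y\<^sup>2 * T' (y\<^sup>2)) \<le> 205 / 100 * y\<^sup>2 * T' (y\<^sup>2)"
        using y2 t by (intro mult_left_mono mult_left_le_one_le) auto
      show "C \<le> 1 / 98 * (y\<^sup>2 * T' (y\<^sup>2))"
        using elim(1) mult_nonneg_nonneg[OF y2(1) less_imp_le[OF t(2)]] unfolding P by linarith
    qed
    finally have "y\<^sup>2 * T' y \<le> y\<^sup>2 * ((205 / 100 + 1 / 98) * T' (y\<^sup>2))"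
      by (simp add: algebra_simps)
    then have "T' y \<le> (205 / 100 + 1 / 98) * T' (y\<^sup>2)"
      using y2 by (subst (asm) mult_le_cancel_left_pos) auto
    also have "\<dots> \<le> 21 / 10 * T' (y\<^sup>2)"
      using t by (intro mult_right_mono) auto
    finally have 1: "T' y \<le> 21 / 10 * T' (y\<^sup>2)" .
    have "y\<^sup>2 * T' y + C \<ge> 195 / 100 * y\<^sup>2 * (y\<^sup>2 * T' (y\<^sup>2))"
      using C(2)[OF y(1,2)] unfolding P by (simp add: power2_eq_square mult_ac)
    moreover have "195 / 100 * y\<^sup>2 * (y\<^sup>2 * T' (y\<^sup>2)) \<ge> y\<^sup>2 * (195 / 100 * (98 / 100) * T' (y\<^sup>2))"
    proof -
      have "98 / 100 * T' (y\<^sup>2) \<le> y\<^sup>2 * T' (y\<^sup>2)" using y2 t by (intro mult_right_mono) auto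
      then have "195 / 100 * y\<^sup>2 * (98 / 100 * T' (y\<^sup>2)) \<le> 195 / 100 * y\<^sup>2 * (y\<^sup>2 * T' (y\<^sup>2))"
        by (intro mult_left_mono) auto
      then show ?thesis by (simp add: mult_ac)
    qed
    moreover have "C \<le> y\<^sup>2 * (1 / 100 * T' (y\<^sup>2))"
      using elim(1) unfolding P by (simp add: mult_ac)
    ultimately have "y\<^sup>2 * (195 / 100 * (98 / 100) * T' (y\<^sup>2)) \<le> y\<^sup>2 * T' y + y\<^sup>2 * (1 / 100 * T' (y\<^sup>2))"
      by linarith
    then have "y\<^sup>2 * (195 / 100 * (98 / 100) * T' (y\<^sup>2)) \<le> y\<^sup>2 * (T' y + (1 / 100 * T' (y\<^sup>2)))"
      by (simp add: algebra_simps)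
    then have "195 / 100 * (98 / 100) * T' (y\<^sup>2) \<le> T' y + (1 / 100 * T' (y\<^sup>2))"
      using y2 by (subst (asm) mult_le_cancel_left_pos) auto
    then have "19 / 10 * T' (y\<^sup>2) \<le> T' y" using t by linarith
    with 1 show ?case by simp
  qed
qed

lemma T'_eventually_ge: "eventually (\<lambda>y. 1 \<le> T' y) (at_left 1)"
proof -
  have "eventually (\<lambda>y. 1 \<le> P y) (at_left 1)"
    using P_at_top unfolding filterlim_at_top by blast
  moreover have "eventually (\<lambda>y::real. 0 < y \<and> y < 1) (at_left 1)"
    by (auto simp: eventually_at_left_field intro!: exI[of _ 0])
  ultimately show ?thesis
  proof eventually_elim
    case (elim y)
    have "y * T' y \<le> T' y" using elim T'_pos[of y] by (intro mult_left_le_one_le) auto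
    then show ?case using elim P_eq[of y] by auto
  qed
qed

text \<open>Near \<open>1\<close>, passing from \<open>y\<^sup>2\<close> to \<open>y\<close> doubles \<open>T'\<close> and preserves \<open>1 - T\<close>, within ten per cent. These
  margins are small enough for the final decay rate \<open>3 / 4\<close>.\<close>

definition doubling_from :: "real \<Rightarrow> bool" where
  "doubling_from y0 \<longleftrightarrow> 9 / 10 \<le> y0 \<and> y0 < 1 \<and> (\<forall>y. y0 \<le> y \<longrightarrow> y < 1 \<longrightarrow>
     1 \<le> T' y \<and> 19 / 10 * T' (y\<^sup>2) \<le> T' y \<and> T' y \<le> 21 / 10 * T' (y\<^sup>2) \<and>
     9 / 10 * (1 - T (y\<^sup>2)) \<le> 1 - T y)"

text \<open>The bound on \<open>1 - T\<close> follows from those on \<open>T'\<close> by integration: \<open>1 - T y - 9 / 10 * (1 - T (y\<^sup>2))\<close> tends to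
  \<open>0\<close> at \<open>1\<close> and its derivative \<open>- T' y + 18 / 10 * y * T' (y\<^sup>2)\<close> is not positive.\<close>

lemma doubling_from_exists:
  obtains y0 where "doubling_from y0"
proof -
  obtain a1 where a1: "a1 < 1" "\<And>y. a1 < y \<Longrightarrow> y < 1 \<Longrightarrow> 19 / 10 * T' (y\<^sup>2) \<le> T' y \<and> T' y \<le> 21 / 10 * T' (y\<^sup>2)"
    using T'_doubling unfolding eventually_at_left_field by blast
  obtain a2 where a2: "a2 < 1" "\<And>y. a2 < y \<Longrightarrow> y < 1 \<Longrightarrow> 1 \<le> T' y"
    using T'_eventually_ge unfolding eventually_at_left_field by blast
  define a where "a = max (9/10) (max a1 a2)"
  have a: "a < 1" "a1 \<le> a" "a2 \<le> a" "9/10 \<le> a" using a1 a2 by (auto simp: a_def)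
  define y0 where "y0 = (a + 1) / 2"
  have y0: "9/10 \<le> y0" "y0 < 1" "a < y0" using a by (auto simp: y0_def)
  have lim: "((\<lambda>y. 1 - T y - 9 / 10 * (1 - T (y\<^sup>2))) \<longlongrightarrow> 1 - 1 - 9 / 10 * (1 - 1)) (at_left 1)"
  proof -
    have sq: "filterlim (\<lambda>y::real. y\<^sup>2) (at_left 1) (at_left 1)"
      by real_asymp
    show ?thesis
      by (intro tendsto_intros T_tendsto_1 filterlim_compose[OF T_tendsto_1 sq])
  qed
  have conc: "9 / 10 * (1 - T (y\<^sup>2)) \<le> 1 - T y" if y: "y0 \<le> y" "y < 1" for y
  proof -
    define f where "f z = 1 - T z - 9 / 10 * (1 - T (z\<^sup>2))" for z
    have dec: "f z \<le> f y" if z: "y \<le> z" "z < 1" for z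
    proof (rule DERIV_nonpos_imp_nonincreasing[OF z(1)])
      fix w assume w: "y \<le> w" "w \<le> z"
      then have w1: "0 < w" "w < 1" "a < w" using y z y0 by auto
      have w2: "norm (w\<^sup>2) < 1" using w1 by (auto simp: abs_square_less_1)
      have f': "(f has_real_derivative (0 - T' w - 9 / 10 * (0 - T' (w\<^sup>2) * (2 * w)))) (at w)"
        unfolding f_def [abs_def]
        by (intro DERIV_diff DERIV_cmult DERIV_chain2[where f = T] DERIV_const T_DERIV w2)
          (use w1 in \<open>auto intro!: derivative_eq_intros\<close>)
      have wT: "w * T' (w\<^sup>2) \<le> T' (w\<^sup>2)"
        using w1 w2 T'_pos[of "w\<^sup>2"] by (intro mult_left_le_one_le) auto
      have "0 < T' (w\<^sup>2)" using w1 w2 by (intro T'_pos) auto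
      with wT have "18 / 10 * (w * T' (w\<^sup>2)) \<le> T' w"
        using conjunct1[OF a1(2)[of w]] w1 a by linarith
      then have "0 - T' w - 9 / 10 * (0 - T' (w\<^sup>2) * (2 * w)) \<le> 0"
        by (simp add: mult_ac)
      with f' show "\<exists>d. (f has_real_derivative d) (at w) \<and> d \<le> 0" by blast
    qed
    have "eventually (\<lambda>z. f z \<le> f y) (at_left 1)"
      using y dec by (auto simp: eventually_at_left_field)
    then have "0 \<le> f y"
      using lim unfolding f_def[symmetric] by (intro tendsto_upperbound[of f 0 "at_left 1"]) auto
    then show ?thesis by (simp add: f_def)
  qed
  show ?thesis
    using y0 a a1(2) a2(2) conc by (intro that[of y0]) (auto simp: doubling_from_def)
qed

lemma doubling_fromD:
  assumes "doubling_from y0" "y0 \<le> y" "y < 1"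
  shows "9 / 10 \<le> y" "1 \<le> T' y" "19 / 10 * T' (y\<^sup>2) \<le> T' y" "T' y \<le> 21 / 10 * T' (y\<^sup>2)"
    "9 / 10 * (1 - T (y\<^sup>2)) \<le> 1 - T y"
  using assms unfolding doubling_from_def by auto

text \<open>The factor \<open>(1 - y)\<^sup>2\<close> loses almost \<open>4\<close>, whereas \<open>T' y\<close> gains about \<open>2\<close> and \<open>1 / (1 - T y)\<close> about \<open>1\<close>, which
  makes the ratio close to \<open>1 / 2\<close>.\<close>

lemma tail_scale_sqrt:
  assumes "doubling_from y0" "y0 \<le> y" "y < 1"
  shows "tail_scale (sqrt y) \<le> 3 / 4 * tail_scale y"
proof -
  define z where "z = sqrt y"
  have y: "9 / 10 \<le> y" using doubling_fromD[OF assms] by simp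
  have z2: "z\<^sup>2 = y" using y by (simp add: z_def)
  have z: "y \<le> z" "z < 1" using y assms(3) real_le_rsqrt[of y y]
    by (auto simp: z_def power2_eq_square mult_left_le)
  note d = doubling_fromD[OF assms(1) order.trans[OF assms(2) z(1)] z(2), unfolded z2]
  have l: "0 < 1 - T y" "0 < 1 - T z" using T_less_1[of y] T_less_1[of z] y z assms by auto
  have "36 / 10 \<le> (19 / 10 :: real)\<^sup>2" by (simp add: power2_eq_square)
  also have "\<dots> \<le> (1 + z)\<^sup>2" using d(1) by (intro power_mono) auto
  finally have "(1 - z)\<^sup>2 * (36 / 10) \<le> (1 - z)\<^sup>2 * (1 + z)\<^sup>2" by (intro mult_left_mono) auto
  also have "\<dots> = ((1 - z) * (1 + z))\<^sup>2" by (simp add: power_mult_distrib)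
  also have "(1 - z) * (1 + z) = 1 - y" unfolding z2[symmetric] by (simp add: algebra_simps power2_eq_square)
  finally have u: "(1 - z)\<^sup>2 \<le> (1 - y)\<^sup>2 / (36 / 10)" by simp
  have "(1 - z)\<^sup>2 * T' z / (1 - T z) \<le> ((1 - y)\<^sup>2 / (36 / 10)) * (21 / 10 * T' y) / (9 / 10 * (1 - T y))"
    using u d l T'_pos[of y] y assms(3) by (intro frac_le mult_mono) auto
  also have "\<dots> = 175 / 270 * tail_scale y" unfolding tail_scale_def by simp
  also have "\<dots> \<le> 3 / 4 * tail_scale y"
    using l T'_pos[of y] y assms(3) by (intro mult_right_mono) (auto simp: tail_scale_def)
  finally show ?thesis by (simp add: tail_scale_def z_def)
qed

text \<open>Moves \<open>y\<close> towards \<open>1\<close>. The product \<open>(1 - y) * (1 - T y)\<close> is comparable to \<open>1 - s\<close>, so the last bound limits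
  how much the corresponding size grows.\<close>

lemma iterated_sqrt:
  assumes "doubling_from y0" "y0 \<le> y" "y < 1"
  shows "y \<le> (sqrt ^^ m) y \<and> (sqrt ^^ m) y < 1 \<and> tail_scale ((sqrt ^^ m) y) \<le> (3 / 4) ^ m * tail_scale y \<and>
    (9 / 20) ^ m * ((1 - y) * (1 - T y)) \<le> (1 - (sqrt ^^ m) y) * (1 - T ((sqrt ^^ m) y))"
proof (induction m)
  case 0
  then show ?case using assms by simp
next
  case (Suc m)
  define z where "z = (sqrt ^^ m) y"
  define w where "w = sqrt z"
  have IH: "y \<le> z" "z < 1" "tail_scale z \<le> (3 / 4) ^ m * tail_scale y"
     "(9 / 20) ^ m * ((1 - y) * (1 - T y)) \<le> (1 - z) * (1 - T z)"
    using Suc by (auto simp: z_def)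
  have z: "y0 \<le> z" "9 / 10 \<le> z" using IH assms doubling_fromD(1)[OF assms] by auto
  have w2: "w\<^sup>2 = z" using z by (simp add: w_def)
  have w: "z \<le> w" "w < 1" using z IH(2) real_le_rsqrt[of z z]
    by (auto simp: w_def power2_eq_square mult_left_le)
  have "tail_scale w \<le> 3 / 4 * tail_scale z" unfolding w_def by (rule tail_scale_sqrt[OF assms(1) z(1) IH(2)])
  also have "\<dots> \<le> 3 / 4 * ((3 / 4) ^ m * tail_scale y)" using IH(3) by (intro mult_left_mono) auto
  finally have 1: "tail_scale w \<le> (3 / 4) ^ Suc m * tail_scale y" by simp
  have "(1 - z) / 2 \<le> 1 - w"
  proof -
    have "1 - z = (1 - w) * (1 + w)" unfolding w2[symmetric] by (simp add: algebra_simps power2_eq_square)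
    also have "\<dots> \<le> (1 - w) * 2" using w by (intro mult_left_mono) auto
    finally show ?thesis by simp
  qed
  moreover have "9 / 10 * (1 - T z) \<le> 1 - T w"
    using doubling_fromD(5)[OF assms(1) _ w(2)] w z unfolding w2 by auto
  ultimately have 2: "(1 - z) / 2 * (9 / 10 * (1 - T z)) \<le> (1 - w) * (1 - T w)"
    using T_le_1[of z] z IH w by (intro mult_mono) auto
  have "(9 / 20) ^ Suc m * ((1 - y) * (1 - T y)) = 9 / 20 * ((9 / 20) ^ m * ((1 - y) * (1 - T y)))" by simp
  also have "\<dots> \<le> 9 / 20 * ((1 - z) * (1 - T z))" using IH(4) by (intro mult_left_mono) auto
  also have "\<dots> = (1 - z) / 2 * (9 / 10 * (1 - T z))" by simp
  finally have 3: "(9 / 20) ^ Suc m * ((1 - y) * (1 - T y)) \<le> (1 - w) * (1 - T w)" using 2 by linarith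
  have "(sqrt ^^ Suc m) y = w" by (simp add: w_def z_def)
  then show ?case using 1 3 w IH(1) by (simp only:) auto
qed

text \<open>Moves \<open>y\<close> away from \<open>1\<close>. Here the comparison is made for \<open>T' y / (1 - T y) ^ 3\<close>, which is comparable to
  \<open>U' s\<close> itself.\<close>

lemma iterated_square:
  assumes dbl: "doubling_from y0" and y: "y0 \<le> y ^ (2 ^ k)" "0 \<le> y" "y < 1"
  shows "T' (y ^ (2 ^ k)) / (1 - T (y ^ (2 ^ k))) ^ 3 \<le> (10 / 19) ^ k * (T' y / (1 - T y) ^ 3) \<and>
    (1 - y ^ (2 ^ k)) * (1 - T (y ^ (2 ^ k))) \<le> (20 / 9) ^ k * ((1 - y) * (1 - T y))"
  using y(1)
proof (induction k)
  case 0
  then show ?case by simp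
next
  case (Suc k)
  define w where "w = y ^ (2 ^ k)"
  have w2: "y ^ (2 ^ Suc k) = w\<^sup>2" by (simp add: w_def flip: power_mult) (simp add: mult.commute)
  have w: "0 \<le> w" "w < 1" using y by (auto simp: w_def power_less_one_iff)
  have w2w: "w\<^sup>2 \<le> w" using w by (simp add: power2_eq_square mult_left_le)
  have "y0 \<le> w\<^sup>2" using Suc.prems unfolding w2 .
  then have y0w: "y0 \<le> w" using w2w by simp
  have y02: "9 / 10 \<le> w\<^sup>2" using \<open>y0 \<le> w\<^sup>2\<close> dbl by (auto simp: doubling_from_def)
  have IH: "T' w / (1 - T w) ^ 3 \<le> (10 / 19) ^ k * (T' y / (1 - T y) ^ 3)"
    "(1 - w) * (1 - T w) \<le> (20 / 9) ^ k * ((1 - y) * (1 - T y))"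
    using Suc.IH y0w by (auto simp: w_def)
  note d = doubling_fromD[OF dbl y0w w(2)]
  have l: "0 < 1 - T w" using T_less_1[of w] w by auto
  have lw: "1 - T w \<le> 1 - T (w\<^sup>2)" using T_mono[of "w\<^sup>2" w] w w2w by simp
  have "T' (w\<^sup>2) / (1 - T (w\<^sup>2)) ^ 3 \<le> (10 / 19 * T' w) / (1 - T w) ^ 3"
    using d l lw T'_pos[of w] w by (intro frac_le power_mono) auto
  also have "\<dots> = 10 / 19 * (T' w / (1 - T w) ^ 3)" by simp
  also have "\<dots> \<le> 10 / 19 * ((10 / 19) ^ k * (T' y / (1 - T y) ^ 3))"
    using IH by (intro mult_left_mono) auto
  finally have 1: "T' (w\<^sup>2) / (1 - T (w\<^sup>2)) ^ 3 \<le> (10 / 19) ^ Suc k * (T' y / (1 - T y) ^ 3)" by simp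
  have "1 - w\<^sup>2 = (1 + w) * (1 - w)" by (simp add: algebra_simps power2_eq_square)
  also have "\<dots> \<le> 2 * (1 - w)" using w by (intro mult_right_mono) auto
  finally have "(1 - w\<^sup>2) * (1 - T (w\<^sup>2)) \<le> (2 * (1 - w)) * (10 / 9 * (1 - T w))"
    using d w w2w lw l by (intro mult_mono) auto
  also have "\<dots> = 20 / 9 * ((1 - w) * (1 - T w))"
  proof -
    have "(2 * a) * (10 / 9 * b) = 20 / 9 * (a * b)" for a b :: real by simp
    then show ?thesis .
  qed
  also have "\<dots> \<le> 20 / 9 * ((20 / 9) ^ k * ((1 - y) * (1 - T y)))"
    using IH by (intro mult_left_mono) auto
  finally show ?case unfolding w2 using 1 by simp
qed

end

section \<open>Tauberian bounds for decreasing sequences\<close>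

text \<open>Keep the coefficients \<open>n * Q n\<close> of the derivative with \<open>n \<le> 1 / (2 * x)\<close>. They are at least \<open>n * Q N\<close>, their
  weights \<open>(1 - x) ^ (n - 1)\<close> are at least \<open>1 / 2\<close>, and the sum of these \<open>n\<close> is of order \<open>1 / x\<^sup>2\<close>.\<close>

lemma nonneg_decreasing_tail_le:
  fixes Q :: "nat \<Rightarrow> real"
  assumes dec: "\<And>m n. m \<le> n \<Longrightarrow> Q n \<le> Q m" and nonneg: "\<And>n. 0 \<le> Q n"
    and x: "0 < x" "x \<le> 1 / 4" and N: "1 / (2 * x) \<le> real N"
  shows "Q N \<le> 64 * x\<^sup>2 * gf (diffs Q) (1 - x)"
proof -
  define M where "M = nat \<lfloor>1 / (2 * x)\<rfloor>"
  have M0: "0 \<le> \<lfloor>1 / (2 * x)\<rfloor>" using x by simp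
  have M: "real M \<le> 1 / (2 * x)" "1 / (2 * x) < real M + 1"
    using M0 unfolding M_def by linarith+
  have "1 / (4 * x) \<ge> 1" using x by simp
  then have M4: "1 / (4 * x) \<le> real M" using M by (simp add: field_simps)
  have "M \<le> N" using M N by (metis order.trans of_nat_le_iff)
  have Mx: "real M * x \<le> 1 / 2" using M x by (simp add: field_simps)
  have Q0: "\<bar>Q n\<bar> \<le> Q 0" for n using dec[of 0 n] nonneg[of n] by auto
  have dn: "0 \<le> diffs Q n" for n using nonneg by (simp add: diffs_def)
  have le1: "(\<Sum>n<M. diffs Q n * (1 - x) ^ n) \<le> gf (diffs Q) (1 - x)"
    using dn x by (intro gf_ge_partial_sum summable_diffs_gf summable_bounded_gf[OF Q0]) auto
  have le2: "(\<Sum>n<M. real (Suc n) * Q M / 2) \<le> (\<Sum>n<M. diffs Q n * (1 - x) ^ n)"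
  proof (intro sum_mono)
    fix n assume "n \<in> {..<M}"
    then have n: "n < M" by simp
    have "1 / 2 \<le> 1 - real n * x"
      using Mx mult_right_mono[of "real n" "real M" x] n x by linarith
    also have "\<dots> \<le> (1 - x) ^ n"
      using Bernoulli_inequality[of "-x" n] x by simp
    finally have "1 / 2 \<le> (1 - x) ^ n" .
    then have "real (Suc n) * Q M * (1/2) \<le> real (Suc n) * Q (Suc n) * (1 - x) ^ n"
      using dec[of "Suc n" M] n nonneg by (intro mult_mono mult_left_mono) auto
    then show "real (Suc n) * Q M / 2 \<le> diffs Q n * (1 - x) ^ n"
      by (simp add: diffs_def)
  qed
  have eq1: "(\<Sum>n<M. real (Suc n) * Q M / 2) = (\<Sum>n<M. real (Suc n)) * (Q M / 2)"
    by (simp add: sum_distrib_right)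
  have eq2: "(\<Sum>n<M. real (Suc n)) = real M * (real M + 1) / 2"
    by (induction M) (auto simp: field_simps)
  from order.trans[OF le2 le1] have "real M * (real M + 1) / 2 * (Q M / 2) \<le> gf (diffs Q) (1 - x)"
    unfolding eq1 eq2 .
  moreover have "(1 / (4 * x)) * (1 / (4 * x)) * (Q M / 4) \<le> real M * (real M + 1) * (Q M / 4)"
    using M4 nonneg[of M] x by (intro mult_right_mono mult_mono) auto
  ultimately have "(1 / (4 * x)) * (1 / (4 * x)) * (Q M / 4) \<le> gf (diffs Q) (1 - x)"
    by simp
  then have "Q M \<le> 64 * x\<^sup>2 * gf (diffs Q) (1 - x)"
    using x by (simp add: field_simps power2_eq_square)
  with dec[OF \<open>M \<le> N\<close>] show ?thesis by linarith
qed

text \<open>The converse direction: the coefficients of index below \<open>N\<close> are charged to the derivative at a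
  point \<open>1 - x'\<close> farther from \<open>1\<close>, and the others are at most \<open>n * Q N\<close>. If the derivative at \<open>1 - x'\<close> is
  much smaller than the one at \<open>1 - x\<close>, this bounds \<open>Q N\<close> from below.\<close>

lemma gf_diffs_le_split:
  fixes Q :: "nat \<Rightarrow> real"
  assumes dec: "\<And>m n. m \<le> n \<Longrightarrow> Q n \<le> Q m" and nonneg: "\<And>n. 0 \<le> Q n"
    and x: "0 < x" "x < 1" and x': "0 < x'" "x' < 1" and N: "real N * x' \<le> 1 / 2"
  shows "gf (diffs Q) (1 - x) \<le> 2 * gf (diffs Q) (1 - x') + Q N / x\<^sup>2"
proof -
  have Q0: "\<bar>Q n\<bar> \<le> Q 0" for n using dec[of 0 n] nonneg[of n] by auto
  have dn: "0 \<le> diffs Q n" for n using nonneg by (simp add: diffs_def)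
  have sm: "summable (\<lambda>n. diffs Q n * y ^ n)" if "norm y < 1" for y
    using that by (intro summable_diffs_gf summable_bounded_gf[OF Q0])
  have geo: "(\<lambda>n. real (Suc n) * (1 - x) ^ n) sums (1 / x\<^sup>2)"
    using geometric_deriv_sums[of "1 - x"] x by simp
  have "(\<Sum>n<N. diffs Q n * (1 - x) ^ n) \<le> (\<Sum>n<N. 2 * (diffs Q n * (1 - x') ^ n))"
  proof (intro sum_mono)
    fix n assume "n \<in> {..<N}"
    then have n: "n < N" by simp
    have "1 / 2 \<le> 1 - real n * x'"
      using N mult_right_mono[of "real n" "real N" x'] n x' by linarith
    also have "\<dots> \<le> (1 - x') ^ n"
      using Bernoulli_inequality[of "-x'" n] x' by simp
    finally have *: "1 \<le> 2 * (1 - x') ^ n" by simp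
    have "(1 - x) ^ n \<le> 1" using x by (intro power_le_one) auto
    then have "(1 - x) ^ n \<le> 2 * (1 - x') ^ n" using * by linarith
    then have "diffs Q n * (1 - x) ^ n \<le> diffs Q n * (2 * (1 - x') ^ n)"
      using dn by (intro mult_left_mono)
    then show "diffs Q n * (1 - x) ^ n \<le> 2 * (diffs Q n * (1 - x') ^ n)" by simp
  qed
  also have "\<dots> = 2 * (\<Sum>n<N. diffs Q n * (1 - x') ^ n)" by (simp add: sum_distrib_left)
  also have "\<dots> \<le> 2 * gf (diffs Q) (1 - x')"
    using gf_ge_partial_sum[of "diffs Q" "1 - x'" N] dn sm[of "1 - x'"] x' by simp
  finally have 1: "(\<Sum>n<N. diffs Q n * (1 - x) ^ n) \<le> 2 * gf (diffs Q) (1 - x')" .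
  have smx: "summable (\<lambda>n. diffs Q n * (1 - x) ^ n)" using sm[of "1 - x"] x by simp
  have "(\<Sum>n. diffs Q (n + N) * (1 - x) ^ (n + N)) \<le> (\<Sum>n. Q N * (real (Suc (n + N)) * (1 - x) ^ (n + N)))"
  proof (intro suminf_le)
    show "summable (\<lambda>n. diffs Q (n + N) * (1 - x) ^ (n + N))"
      using summable_ignore_initial_segment[OF smx] .
    show "summable (\<lambda>n. Q N * (real (Suc (n + N)) * (1 - x) ^ (n + N)))"
      using summable_ignore_initial_segment[OF sums_summable[OF geo]] by (intro summable_mult)
    show "diffs Q (n + N) * (1 - x) ^ (n + N) \<le> Q N * (real (Suc (n + N)) * (1 - x) ^ (n + N))" for n
    proof -
      have "Q (Suc (n + N)) * (real (Suc (n + N)) * (1 - x) ^ (n + N))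
          \<le> Q N * (real (Suc (n + N)) * (1 - x) ^ (n + N))"
        using x dec[of N "Suc (n + N)"] by (intro mult_right_mono) auto
      then show ?thesis by (simp add: diffs_def mult_ac)
    qed
  qed
  also have "\<dots> = Q N * (\<Sum>n. real (Suc (n + N)) * (1 - x) ^ (n + N))"
    using summable_ignore_initial_segment[OF sums_summable[OF geo]] by (intro suminf_mult)
  also have "\<dots> \<le> Q N * (1 / x\<^sup>2)"
  proof (intro mult_left_mono nonneg)
    have "0 \<le> (\<Sum>n<N. real (Suc n) * (1 - x) ^ n)" using x by (intro sum_nonneg) auto
    then show "(\<Sum>n. real (Suc (n + N)) * (1 - x) ^ (n + N)) \<le> 1 / x\<^sup>2"
      using suminf_split_initial_segment[OF sums_summable[OF geo], of N] sums_unique[OF geo] by linarith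
  qed
  finally show ?thesis
    using 1 unfolding gf_def[of "diffs Q" "1 - x"] suminf_split_initial_segment[OF smx, of N]
    by simp
qed

section \<open>Tail of a sequence given by the critical branching recursion\<close>

text \<open>\<open>Q\<close> plays the role of the tail of the size of a critical tree. In the recursion \<open>y\<close> is the generating
  function at \<open>s\<close> of the sizes, and \<open>1 - (1 - y) * T y\<close> that of the offspring law at \<open>y\<close>.\<close>

locale critical_recursion = halving_tail +
  fixes Q :: "nat \<Rightarrow> real"
  assumes Q_dec: "\<And>m n. m \<le> n \<Longrightarrow> Q n \<le> Q m"
    and Q_nonneg: "\<And>n. 0 \<le> Q n" and Q_le_1: "\<And>n. Q n \<le> 1"
    and recursion: "\<And>s y. 0 \<le> s \<Longrightarrow> s < 1 \<Longrightarrow> y = 1 - (1 - s) * gf Q s \<Longrightarrow>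
      y = s * (1 - (1 - y) * T y)"
begin

abbreviation U where "U \<equiv> gf Q"
abbreviation U' where "U' \<equiv> gf (diffs Q)"

text \<open>The generating functions of the sizes and of the offspring law, recovered from those of the two tails.\<close>

definition F where "F s = 1 - (1 - s) * U s"
definition G where "G y = 1 - (1 - y) * T y"

lemma F_recursion: "0 \<le> s \<Longrightarrow> s < 1 \<Longrightarrow> F s = s * G (F s)"
  using recursion[of s "F s"] by (simp add: F_def G_def)

lemma U_summable: "norm y < 1 \<Longrightarrow> summable (\<lambda>n. Q n * y ^ n)"
  using Q_nonneg Q_le_1 by (intro summable_bounded_gf[of _ 1]) auto

lemma U_DERIV: "norm y < 1 \<Longrightarrow> (U has_real_derivative U' y) (at y)"
  using gf_DERIV[OF U_summable] by blast

lemma F_bounds: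
  assumes s: "0 \<le> s" "s < 1"
  shows "0 \<le> F s" "F s < 1"
proof -
  have "0 \<le> U s"
    unfolding gf_def using s Q_nonneg by (intro suminf_nonneg U_summable) auto
  then have 1: "F s \<le> 1" using s by (simp add: F_def)
  have "U s \<le> (\<Sum>n. s ^ n)"
    unfolding gf_def using s Q_le_1 Q_nonneg
    by (intro suminf_le U_summable summable_geometric) (auto intro: mult_left_le_one_le)
  also have "\<dots> = 1 / (1 - s)" using s by (simp add: suminf_geometric)
  finally show "0 \<le> F s" using s by (simp add: F_def field_simps)
  have "F s \<noteq> 1" using F_recursion[OF s] s by (auto simp: G_def)
  with 1 show "F s < 1" by simp
qed

lemma G_bounds:
  assumes y: "0 \<le> y" "y < 1"
  shows "y < G y" "G y \<le> 1"
proof -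
  have "(1 - y) * T y < (1 - y) * 1"
    using y T_less_1[OF y] by (intro mult_strict_left_mono) auto
  then show "y < G y" by (simp add: G_def)
  show "G y \<le> 1" using y T_nonneg[OF y] by (simp add: G_def)
qed

text \<open>The recursion solved for \<open>s\<close>: near \<open>1\<close> it says that \<open>1 - s\<close> is about \<open>(1 - y) * (1 - T y)\<close>.\<close>

lemma inversion:
  assumes s: "0 \<le> s" "s < 1"
  shows "(1 - s) * G (F s) = (1 - F s) * (1 - T (F s))"
  using F_recursion[OF s] by (simp add: G_def algebra_simps)

text \<open>The squares and square roots of \<open>y\<close> that appear in the doubling argument must be values of \<open>F\<close>. The
  intermediate value theorem applies because \<open>F\<close> tends to \<open>1\<close> by \<open>inversion\<close>.\<close>

lemma F_surj:
  assumes y: "0 \<le> y" "y < 1"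
  obtains s where "0 \<le> s" "s < 1" "F s = y"
proof -
  obtain e where e: "0 < e" "e < 1" "e < (1 - y) * (1 - T y)"
  proof -
    have "0 < (1 - y) * (1 - T y)" using y T_less_1[OF y] by simp
    then obtain e where "0 < e" "e < min 1 ((1 - y) * (1 - T y))"
      using dense[of 0 "min 1 ((1 - y) * (1 - T y))"] by auto
    with that show ?thesis by auto
  qed
  define s1 where "s1 = 1 - e"
  have s1: "0 \<le> s1" "s1 < 1" using e by (auto simp: s1_def)
  have "y \<le> F s1"
  proof (rule ccontr)
    assume "\<not> ?thesis"
    then have lt: "F s1 < y" by simp
    have "(1 - y) * (1 - T y) \<le> (1 - F s1) * (1 - T (F s1))"
      using lt y F_bounds[OF s1] T_mono[of "F s1" y] T_le_1[of y] by (intro mult_mono) auto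
    also have "\<dots> = e * G (F s1)" using inversion[OF s1] by (simp add: s1_def)
    also have "\<dots> \<le> e" using G_bounds[OF F_bounds[OF s1]] e by (intro mult_left_le) auto
    finally show False using e by simp
  qed
  moreover have "F 0 \<le> y" using F_recursion[of 0] y by simp
  moreover have "isCont F x" if "0 \<le> x" "x \<le> s1" for x
  proof -
    have "isCont U x" using U_DERIV[of x] that s1 by (intro DERIV_isCont) auto
    then show ?thesis unfolding F_def [abs_def] by (intro continuous_intros) auto
  qed
  ultimately obtain s where "0 \<le> s" "s \<le> s1" "F s = y"
    using IVT[of F 0 y s1] s1 by auto
  with s1 that show ?thesis by auto
qed

lemma F_large:
  assumes y: "0 \<le> y" "y < 1" and s: "0 \<le> s" "s < 1" and lt: "1 - s < (1 - y) * (1 - T y)"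
  shows "y < F s"
proof (rule ccontr)
  assume "\<not> ?thesis"
  then have le: "F s \<le> y" by simp
  have "(1 - y) * (1 - T y) \<le> (1 - F s) * (1 - T (F s))"
    using le y F_bounds[OF s] T_mono[of "F s" y] T_le_1[of y] by (intro mult_mono) auto
  also have "\<dots> = (1 - s) * G (F s)" using inversion[OF s] by simp
  also have "\<dots> \<le> 1 - s" using G_bounds[OF F_bounds[OF s]] s by (intro mult_left_le) auto
  finally show False using lt by simp
qed

text \<open>Differentiating the recursion at \<open>s\<close> gives \<open>D * K = (G y)\<^sup>2\<close> for \<open>D = F' s\<close> and
  \<open>K = 1 - T y + (1 - y) * y * T' y\<close>. Substituting \<open>D = U s - (1 - s) * U' s\<close> and \<open>U s = G y / (1 - T y)\<close> and
  applying \<open>inversion\<close> leaves a common factor \<open>1 - s\<close>, which is cancelled. The denominators are kept on the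
  left-hand side.\<close>

lemma U'_formula:
  assumes s: "0 < s" "s < 1" and y: "y = F s"
  shows "U' s * ((1 - T y)\<^sup>2 * (1 - T y + (1 - y) * y * T' y)) =
    (G y)\<^sup>2 * ((1 - T y) * T y + y * T' y)"
proof -
  have yb: "0 \<le> y" "y < 1" using F_bounds[of s] s y by auto
  have ny: "norm y < 1" and ns: "norm s < 1" using yb s by auto
  define D where "D = U s - (1 - s) * U' s"
  have F': "(F has_real_derivative D) (at s)"
    unfolding F_def [abs_def] D_def
    by (rule derivative_eq_intros U_DERIV[OF ns] refl | simp)+
  have "((\<lambda>z. z * (1 - (1 - F z) * T (F z))) has_real_derivative
     (1 * (1 - (1 - F s) * T (F s)) + (0 - ((0 - D) * T (F s) + (T' (F s) * D) * (1 - F s))) * s)) (at s)"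
    by (intro DERIV_mult DERIV_diff DERIV_const DERIV_ident F' DERIV_chain2[where f = T] T_DERIV)
      (use ny y in auto)
  moreover have "eventually (\<lambda>z. F z = z * (1 - (1 - F z) * T (F z))) (nhds s)"
  proof -
    have "eventually (\<lambda>z. z \<in> {0<..<1}) (nhds s)"
      using s by (intro eventually_nhds_in_open) auto
    then show ?thesis
    proof eventually_elim
      case (elim z)
      then show ?case using F_recursion[of z] by (simp add: G_def)
    qed
  qed
  ultimately have "(F has_real_derivative
     (1 * (1 - (1 - F s) * T (F s)) + (0 - ((0 - D) * T (F s) + (T' (F s) * D) * (1 - F s))) * s)) (at s)"
    by (subst DERIV_cong_ev[OF refl _ refl]) auto
  note D_eq = DERIV_unique[OF F' this]
  have D: "D = G y + s * ((T y - (1 - y) * T' y) * D)"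
    by (rule trans[OF D_eq]) (simp add: y[symmetric] G_def algebra_simps)
  have ys: "y = s * G y" using F_recursion[of s] s y by simp
  have xg: "(1 - s) * G y = (1 - y) * (1 - T y)" using inversion[of s] s y by simp
  have Ux: "U s * (1 - s) = 1 - y" unfolding y F_def by simp
  have U: "U s * (1 - T y) = G y"
  proof -
    have "(1 - s) * (U s * (1 - T y)) = (1 - s) * G y"
      using xg Ux by (simp add: mult_ac)
    then show ?thesis using s by simp
  qed
  define K where "K = 1 - T y + (1 - y) * y * T' y"
  have K: "K = G y - y * (T y - (1 - y) * T' y)" by (simp add: K_def G_def algebra_simps)
  have DK: "D * K = (G y)\<^sup>2"
  proof -
    have "D * K = G y * D - s * G y * (T y - (1 - y) * T' y) * D"
      unfolding K by (subst ys) (simp add: algebra_simps)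
    also have "\<dots> = G y * (D - s * ((T y - (1 - y) * T' y) * D))" by (simp add: algebra_simps)
    also have "D - s * ((T y - (1 - y) * T' y) * D) = G y" using D by linarith
    finally show ?thesis by (simp add: power2_eq_square)
  qed
  have "(1 - s) * (U' s * ((1 - T y)\<^sup>2 * K)) = ((U s - D) * (1 - T y)\<^sup>2 * K)"
    by (simp add: D_def algebra_simps)
  also have "\<dots> = (U s * (1 - T y)) * (1 - T y) * K - (D * K) * (1 - T y)\<^sup>2"
    by (simp add: algebra_simps power2_eq_square)
  also have "\<dots> = G y * (1 - T y) * (K - G y * (1 - T y))"
    unfolding U DK by (simp add: algebra_simps power2_eq_square)
  also have "K - G y * (1 - T y) = (1 - y) * ((1 - T y) * T y + y * T' y)"
    by (simp add: K_def G_def algebra_simps)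
  also have "G y * (1 - T y) * ((1 - y) * ((1 - T y) * T y + y * T' y)) =
      G y * ((1 - y) * (1 - T y)) * ((1 - T y) * T y + y * T' y)" by (simp add: mult_ac)
  also have "\<dots> = (1 - s) * ((G y)\<^sup>2 * ((1 - T y) * T y + y * T' y))"
    unfolding xg[symmetric] by (simp add: power2_eq_square mult_ac)
  finally show ?thesis using s unfolding K_def by simp
qed

text \<open>In \<open>U'_formula\<close>, convexity of \<open>T\<close> bounds \<open>(1 - y) * T' y\<close> by \<open>1 - T y\<close>, so \<open>1 - T y + (1 - y) * y * T' y\<close> lies
  between \<open>1 - T y\<close> and twice that, while \<open>(1 - T y) * T y + y * T' y\<close> is \<open>T' y\<close> up to constants because
  \<open>T' y\<close> is bounded below by \<open>1\<close>.\<close>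

lemma U'_bounds:
  assumes s: "0 < s" "s < 1" and y: "y = F s" "1 / 2 \<le> y" and t: "1 \<le> T' y"
  shows "U' s \<le> 2 * T' y / (1 - T y) ^ 3" "T' y / (16 * (1 - T y) ^ 3) \<le> U' s"
proof -
  have yb: "0 \<le> y" "y < 1" using F_bounds[of s] s y by auto
  define l where "l = 1 - T y"
  define K where "K = l + (1 - y) * y * T' y"
  define N where "N = (G y)\<^sup>2 * (l * T y + y * T' y)"
  have l: "0 < l" "l \<le> 1" using T_less_1[OF yb] T_nonneg[OF yb] by (auto simp: l_def)
  have eq: "U' s * (l\<^sup>2 * K) = N" using U'_formula[OF s y(1)] by (simp add: l_def K_def N_def)
  have g: "1 / 2 \<le> G y" "G y \<le> 1" using G_bounds[OF yb] y by auto
  have K0: "0 \<le> (1 - y) * y * T' y" using yb t by simp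
  have "(1 - y) * y * T' y = y * ((1 - y) * T' y)" by simp
  also have "\<dots> \<le> (1 - y) * T' y" using yb t by (intro mult_left_le_one_le) auto
  also have "\<dots> \<le> l" using T'_le_difference_quotient[OF yb] by (simp add: l_def)
  finally have K: "l \<le> K" "K \<le> 2 * l" using K0 by (auto simp: K_def)
  have lT: "0 \<le> l * T y" "l * T y \<le> T' y"
    using l T_nonneg[OF yb] T_le_1[OF yb] t by (auto intro!: order.trans[OF mult_left_le_one_le])
  have yT: "T' y / 2 \<le> y * T' y" "y * T' y \<le> T' y"
    using y yb t mult_right_mono[of "1/2" y "T' y"] by auto
  have g2: "1 / 4 \<le> (G y)\<^sup>2" "(G y)\<^sup>2 \<le> 1"
    using power_mono[OF g(1), of 2] power_le_one[of "G y" 2] g by (simp_all add: power_divide)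
  have "0 \<le> l * T y + y * T' y" "l * T y + y * T' y \<le> 2 * T' y"
    and sum_ge: "T' y / 2 \<le> l * T y + y * T' y"
    using lT yT t by linarith+
  then have N1: "N \<le> 2 * T' y"
    unfolding N_def using g2 by (intro order.trans[OF mult_left_le_one_le]) auto
  have N2: "1 / 4 * (T' y / 2) \<le> N"
    unfolding N_def using g2 t by (intro mult_mono[OF _ sum_ge]) auto
  have pos: "0 < l\<^sup>2 * K" using l K by auto
  have U': "U' s = N / (l\<^sup>2 * K)" using eq pos by (metis nonzero_eq_divide_eq less_irrefl)
  have N0: "0 \<le> N" using N2 t by linarith
  have "N / (l\<^sup>2 * K) \<le> 2 * T' y / (l\<^sup>2 * l)"
    using N1 K l pos t by (intro frac_le mult_left_mono) auto
  then show "U' s \<le> 2 * T' y / (1 - T y) ^ 3"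
    unfolding U' l_def[symmetric] by (simp add: power3_eq_cube power2_eq_square)
  have "1 / 4 * (T' y / 2) / (l\<^sup>2 * (2 * l)) \<le> N / (l\<^sup>2 * K)"
    using N2 K l pos N0 by (intro frac_le mult_left_mono) auto
  then show "T' y / (16 * (1 - T y) ^ 3) \<le> U' s"
    unfolding U' l_def[symmetric] by (simp add: power3_eq_cube power2_eq_square)
qed

lemma inversion_bounds:
  assumes s: "0 \<le> s" "s < 1" and y: "y = F s" "1 / 2 \<le> y"
  shows "(1 - y) * (1 - T y) \<le> 1 - s" "1 - s \<le> 2 * ((1 - y) * (1 - T y))"
proof -
  have g: "1 / 2 \<le> G y" "G y \<le> 1" using G_bounds[of y] F_bounds[OF s] y by auto
  have xg: "(1 - y) * (1 - T y) = (1 - s) * G y" using inversion[OF s] y by simp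
  show "(1 - y) * (1 - T y) \<le> 1 - s"
    unfolding xg using g s by (intro mult_left_le) auto
  show "1 - s \<le> 2 * ((1 - y) * (1 - T y))"
    unfolding xg using g s mult_left_mono[of "1/2" "G y" "1 - s"] by simp
qed

lemma tail_scale_bounds:
  assumes s: "0 < s" "s < 1" and y: "y = F s" "1 / 2 \<le> y" and t: "1 \<le> T' y"
  shows "(1 - s)\<^sup>2 * U' s \<le> 8 * tail_scale y" "tail_scale y \<le> 16 * ((1 - s)\<^sup>2 * U' s)"
proof -
  have yb: "0 \<le> y" "y < 1" using F_bounds[of s] s y by auto
  define l where "l = 1 - T y"
  define x where "x = 1 - s"
  have x: "0 < x" using s by (simp add: x_def)
  have l: "0 < l" using T_less_1[OF yb] by (auto simp: l_def)
  have x1: "x \<le> 2 * ((1 - y) * l)" and x2: "(1 - y) * l \<le> x"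
    using inversion_bounds[of s y] s y by (simp_all add: x_def l_def)
  have u: "0 < (1 - y) * l" using yb l by simp
  have U: "U' s \<le> 2 * T' y / l ^ 3" "T' y / (16 * l ^ 3) \<le> U' s"
    using U'_bounds[OF assms] by (simp_all add: l_def)
  have U0: "0 \<le> T' y / (16 * l ^ 3)" using t l by auto
  have "x\<^sup>2 * U' s \<le> (2 * ((1 - y) * l))\<^sup>2 * (2 * T' y / l ^ 3)"
    using x1 x U U0 by (intro mult_mono power_mono) auto
  also have "\<dots> = 8 * tail_scale y"
    using l unfolding tail_scale_def l_def[symmetric] by (simp add: field_simps power2_eq_square power3_eq_cube)
  finally show "(1 - s)\<^sup>2 * U' s \<le> 8 * tail_scale y" by (simp add: x_def)
  have "tail_scale y = 16 * (((1 - y) * l)\<^sup>2 * (T' y / (16 * l ^ 3)))"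
    using l unfolding tail_scale_def l_def[symmetric] by (simp add: field_simps power2_eq_square power3_eq_cube)
  also have "((1 - y) * l)\<^sup>2 * (T' y / (16 * l ^ 3)) \<le> x\<^sup>2 * U' s"
    using x2 u x U U0 by (intro mult_mono power_mono) auto
  finally show "tail_scale y \<le> 16 * ((1 - s)\<^sup>2 * U' s)" unfolding x_def by simp
qed

text \<open>Squaring \<open>y\<close> eight times gives \<open>z = y ^ 256\<close>, for which \<open>U'\<close> is smaller by the factor
  \<open>32 * (10 / 19) ^ 8 < 1 / 4\<close>, constants of \<open>U'_bounds\<close> included. The corresponding \<open>1 - s'\<close> is at most
  \<open>2000 * x\<close> because \<open>2 * (20 / 9) ^ 8 < 2000\<close>; this is why \<open>x\<close> is taken to be \<open>1 / (4000 * n)\<close>.\<close>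

lemma scale_le_tail:
  assumes dbl: "doubling_from y0" and n: "n > 0" and x: "x = 1 / (4000 * real n)"
    and y: "y = F (1 - x)" "y0 \<le> y ^ 256"
  shows "tail_scale y \<le> 32 * Q n"
proof -
  have x01: "0 < x" "x < 1" using n by (auto simp: x field_simps)
  have yb: "0 \<le> y" "y < 1" using F_bounds[of "1 - x"] x01 y by auto
  have y00: "9 / 10 \<le> y0" using dbl by (simp add: doubling_from_def)
  have "y ^ 256 \<le> y ^ 1" using yb by (intro power_decreasing) auto
  then have y0y: "y0 \<le> y" using y by simp
  define z where "z = y ^ 256"
  have z: "9 / 10 \<le> z" "z < 1" using y00 y yb by (auto simp: z_def power_less_one_iff)
  obtain s' where s': "0 \<le> s'" "s' < 1" "F s' = z" using F_surj[of z] z by auto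
  define x' where "x' = 1 - s'"
  have "s' \<noteq> 0" using F_recursion[of 0] s' z by auto
  then have x': "0 < x'" "x' < 1" "s' = 1 - x'" using s' by (auto simp: x'_def)
  note sq = iterated_square[OF dbl, of y 8, simplified, folded z_def, OF y(2)[folded z_def] yb]
  have y12: "1 / 2 \<le> y" "1 / 2 \<le> z" using y0y y00 z by auto
  have tz: "1 \<le> T' z" "1 \<le> T' y"
    using doubling_fromD(2)[OF dbl _ z(2)] y doubling_fromD(2)[OF dbl y0y yb(2)] by (auto simp: z_def)
  have "x' \<le> 2 * ((1 - z) * (1 - T z))"
    using inversion_bounds(2)[of s' z] s' y12 by (simp add: x'_def)
  also have "\<dots> \<le> 2 * ((20 / 9) ^ 8 * ((1 - y) * (1 - T y)))"
    using sq by (intro mult_left_mono) auto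
  also have "\<dots> \<le> 2 * ((20 / 9) ^ 8 * x)"
    using inversion_bounds(1)[of "1 - x" y] x01 y y12 by (intro mult_left_mono) auto
  also have "\<dots> \<le> 2 * (1000 * x)"
    using x01 by (intro mult_left_mono mult_right_mono) (simp_all add: field_simps)
  finally have "x' \<le> 2000 * x" by simp
  then have nx: "real n * x' \<le> 1 / 2" using n by (simp add: x field_simps)
  have "U' (1 - x') \<le> 2 * T' z / (1 - T z) ^ 3"
    using U'_bounds(1)[of s' z] s' x' y12 tz by auto
  also have "\<dots> = 2 * (T' z / (1 - T z) ^ 3)" by simp
  also have "\<dots> \<le> 2 * ((10 / 19) ^ 8 * (T' y / (1 - T y) ^ 3))"
    using sq by (intro mult_left_mono) auto
  also have "\<dots> = 32 * (10 / 19) ^ 8 * (T' y / (16 * (1 - T y) ^ 3))" by simp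
  also have "\<dots> \<le> 32 * (10 / 19) ^ 8 * U' (1 - x)"
    using U'_bounds(2)[of "1 - x" y] x01 y y12 tz by (intro mult_left_mono) auto
  also have "\<dots> \<le> 1 / 4 * U' (1 - x)"
  proof (intro mult_right_mono)
    have "0 \<le> T' y / (16 * (1 - T y) ^ 3)" using tz T_le_1[OF yb] by auto
    then show "0 \<le> U' (1 - x)"
      using U'_bounds(2)[of "1 - x" y] x01 y y12 tz by auto
  qed (simp add: field_simps)
  finally have "U' (1 - x') \<le> 1 / 4 * U' (1 - x)" .
  moreover have "U' (1 - x) \<le> 2 * U' (1 - x') + Q n / x\<^sup>2"
    using Q_dec Q_nonneg x01 x' nx by (intro gf_diffs_le_split) auto
  ultimately have "U' (1 - x) \<le> 2 * (Q n / x\<^sup>2)" by linarith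
  then have "x\<^sup>2 * U' (1 - x) \<le> x\<^sup>2 * (2 * (Q n / x\<^sup>2))" by (intro mult_left_mono) auto
  then have "x\<^sup>2 * U' (1 - x) \<le> 2 * Q n" using x01 by simp
  then show ?thesis using tail_scale_bounds(2)[of "1 - x" y] x01 y y12 tz by auto
qed

text \<open>Taking \<open>m\<close> square roots of \<open>y\<close> multiplies the relevant size \<open>1 / x\<close> by at most \<open>(20 / 9) ^ m\<close> (up to a
  constant) and the scale by at most \<open>(3 / 4) ^ m\<close>; at the new point the tail is bounded by the scale.\<close>

lemma tail_le_scale:
  assumes dbl: "doubling_from y0" and x: "0 < x" "x < 1"
    and y: "y = F (1 - x)" "y0 \<le> y" and N: "(20 / 9) ^ m / x \<le> real N"
  shows "Q N \<le> 512 * ((3 / 4) ^ m * tail_scale y)"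
proof -
  have yb: "0 \<le> y" "y < 1" using F_bounds[of "1 - x"] x y by auto
  define z where "z = (sqrt ^^ m) y"
  have it: "y \<le> z" "z < 1" "tail_scale z \<le> (3 / 4) ^ m * tail_scale y"
    "(9 / 20) ^ m * ((1 - y) * (1 - T y)) \<le> (1 - z) * (1 - T z)"
    using iterated_sqrt[OF dbl y(2) yb(2), of m] by (auto simp: z_def)
  have z: "9 / 10 \<le> z" "1 \<le> T' z"
    using doubling_fromD(1,2)[OF dbl _ it(2)] y it by auto
  have y9: "1 / 2 \<le> y" using doubling_fromD(1)[OF dbl y(2) yb(2)] by simp
  obtain s' where s': "0 \<le> s'" "s' < 1" "F s' = z" using F_surj[of z] z it by auto
  define x' where "x' = 1 - s'"
  have "s' \<noteq> 0" using F_recursion[of 0] s' z by auto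
  then have x': "0 < x'" "x' < 1" "s' = 1 - x'" using s' by (auto simp: x'_def)
  have "(9 / 20) ^ m * (x / 2) \<le> (9 / 20) ^ m * ((1 - y) * (1 - T y))"
    using inversion_bounds(2)[of "1 - x" y] x y y9 by (intro mult_left_mono) auto
  also have "\<dots> \<le> x'"
    using it(4) inversion_bounds(1)[of s' z] s' z by (simp add: x'_def)
  finally have lo: "(9 / 20) ^ m * (x / 2) \<le> x'" .
  have "1 / (2 * x') \<le> 1 / (2 * ((9 / 20) ^ m * (x / 2)))"
    using lo x x' by (intro divide_left_mono mult_left_mono) auto
  also have "\<dots> = (20 / 9) ^ m / x"
    by (simp add: power_divide)
  finally have Nx: "1 / (2 * x') \<le> real N" using N by simp
  have "x' \<le> 2 * ((1 - z) * (1 - T z))"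
    using inversion_bounds(2)[of s' z] s' z by (simp add: x'_def)
  also have "(1 - z) * (1 - T z) \<le> 1 / 10 * 1"
    using z it T_nonneg[of z] T_le_1[of z] by (intro mult_mono) auto
  finally have "x' \<le> 1 / 4" by simp
  then have "Q N \<le> 64 * x'\<^sup>2 * U' (1 - x')"
    using Q_dec Q_nonneg x' Nx by (intro nonneg_decreasing_tail_le) auto
  also have "\<dots> \<le> 512 * tail_scale z"
    using tail_scale_bounds(1)[of s' z] s' x' z by auto
  also have "\<dots> \<le> 512 * ((3 / 4) ^ m * tail_scale y)" using it by simp
  finally show ?thesis .
qed

theorem tail_ratio_small:
  assumes "0 < \<epsilon>"
  obtains A n0 where "A > 0" "\<And>n. n \<ge> n0 \<Longrightarrow> Q (A * n) \<le> \<epsilon> * Q n"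
proof -
  obtain y0 where dbl: "doubling_from y0" using doubling_from_exists .
  \<comment> \<open>With this threshold the point \<open>y ^ 256\<close> of \<open>scale_le_tail\<close> still lies in the doubling region.\<close>
  define y1 where "y1 = root 256 y0"
  have y0: "9 / 10 \<le> y0" "y0 < 1" using dbl by (auto simp: doubling_from_def)
  have y1: "0 \<le> y1" "y1 < 1" "y1 ^ 256 = y0" using y0 by (auto simp: y1_def)
  have e: "0 < (1 - y1) * (1 - T y1)" using y1 T_less_1[of y1] by simp
  obtain n0 :: nat where n0: "1 / (4000 * ((1 - y1) * (1 - T y1))) < real n0"
    using reals_Archimedean2 by blast
  obtain m where m: "(3 / 4 :: real) ^ m < \<epsilon> / (512 * 32)"
    using real_arch_pow_inv[of "\<epsilon> / (512 * 32)" "3 / 4"] assms by auto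
  obtain A :: nat where A: "4000 * (20 / 9) ^ m < real A"
    using reals_Archimedean2 by blast
  have "0 < real A" by (rule order.strict_trans[OF _ A]) simp
  show ?thesis
  proof (rule that[of A "max 1 n0"])
    show "A > 0" using \<open>0 < real A\<close> by simp
    fix n assume n: "max 1 n0 \<le> n"
    define x where "x = 1 / (4000 * real n)"
    have x: "0 < x" "x < 1" using n by (auto simp: x_def field_simps)
    have "x < (1 - y1) * (1 - T y1)"
    proof -
      have "1 / (4000 * ((1 - y1) * (1 - T y1))) < real n" using n0 n by linarith
      then show ?thesis using e n by (simp add: x_def field_simps)
    qed
    then have lt: "y1 < F (1 - x)" using y1 x by (intro F_large) auto
    define y where "y = F (1 - x)"
    have yb: "0 \<le> y" "y < 1" using F_bounds[of "1 - x"] x by (auto simp: y_def)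
    have y256: "y0 \<le> y ^ 256" using lt y1 power_mono[of y1 y 256] by (simp add: y_def)
    also have "y ^ 256 \<le> y ^ 1" using yb by (intro power_decreasing) auto
    finally have y0y: "y0 \<le> y" by simp
    have "(20 / 9) ^ m / x = 4000 * (20 / 9) ^ m * real n" by (simp add: x_def)
    also have "\<dots> \<le> real (A * n)" using A by (simp add: mult_right_mono)
    finally have "Q (A * n) \<le> 512 * ((3 / 4) ^ m * tail_scale y)"
      using x y0y by (intro tail_le_scale[OF dbl]) (auto simp: y_def)
    also have "\<dots> \<le> 512 * ((3 / 4) ^ m * (32 * Q n))"
      using n y256 by (intro mult_left_mono scale_le_tail[OF dbl]) (auto simp: x_def y_def)
    also have "\<dots> = (512 * 32 * (3 / 4) ^ m) * Q n" by simp
    also have "\<dots> \<le> \<epsilon> * Q n"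
      using m Q_nonneg by (intro mult_right_mono) auto
    finally show "Q (A * n) \<le> \<epsilon> * Q n" .
  qed
qed

end

section \<open>Uniform convergence of slowly varying functions\<close>

text \<open>The uniform convergence theorem in additive notation, for \<open>g x = ln (L (exp x))\<close>. Suppose that
  \<open>\<bar>g (X n + u n) - g (X n)\<bar> > \<epsilon>\<close> with \<open>X n\<close> tending to infinity and \<open>u n \<in> {0..a}\<close>. By pointwise
  convergence the increments of \<open>g\<close> from \<open>X n\<close> are below \<open>\<epsilon> / 2\<close> on most of \<open>{0..2 * a}\<close>, and so are those
  from \<open>X n + u n\<close>. Shifted by \<open>u n\<close>, the second set still lies in \<open>{0..3 * a}\<close>; both have measure more
  than \<open>3 / 2 * a\<close>, so they meet, and at a common point the two increments combine to a contradiction.\<close>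

lemma slowly_varying_uniform_additive:
  assumes sv: "slowly_varying L" and a: "0 < a" and \<epsilon>: "0 < \<epsilon>"
  shows "\<exists>x0. \<forall>x\<ge>x0. \<forall>u\<in>{0..a}. 0 < L (exp x) \<and> 0 < L (exp (x + u)) \<and>
    \<bar>ln (L (exp (x + u))) - ln (L (exp x))\<bar> \<le> \<epsilon>"
proof -
  obtain b where b: "\<And>x. x \<ge> b \<Longrightarrow> L x > 0" "L \<in> borel_measurable (restrict_space borel {b..})"
    and lim: "\<And>t. t > 0 \<Longrightarrow> ((\<lambda>x. L (t * x) / L x) \<longlongrightarrow> 1) at_top"
    using sv unfolding slowly_varying_def by auto
  define c where "c = ln (max 1 b)"
  have c: "b \<le> exp x" if "c \<le> x" for x
  proof -
    have "b \<le> exp c" by (simp add: c_def)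
    also have "\<dots> \<le> exp x" using that by simp
    finally show ?thesis .
  qed
  have pos: "0 < L (exp x)" if "c \<le> x" for x
    using b(1) c that by blast
  define g where "g x = (if x \<in> {c..} then ln (L (exp x)) else 0)" for x
  have g [measurable]: "g \<in> borel_measurable borel"
  proof -
    have "(\<lambda>x. exp x) \<in> measurable (restrict_space borel {c..}) (restrict_space borel {b..})"
      using c by (intro measurable_restrict_space2 measurable_restrict_space1) (auto simp: space_restrict_space)
    from measurable_compose[OF this b(2)]
    have "(\<lambda>x. ln (L (exp x))) \<in> borel_measurable (restrict_space borel {c..})"
      by measurable
    then show ?thesis
      unfolding g_def [abs_def] by (subst (asm) measurable_restrict_space_iff[where c = 0]) auto
  qed
  have g_lim: "((\<lambda>x. g (x + v) - g x) \<longlongrightarrow> 0) at_top" if "0 \<le> v" for v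
  proof -
    have "((\<lambda>x. ln (L (exp v * exp x) / L (exp x))) \<longlongrightarrow> ln 1) at_top"
      by (intro tendsto_ln filterlim_compose[OF lim exp_at_top]) auto
    moreover have "eventually (\<lambda>x. ln (L (exp v * exp x) / L (exp x)) = g (x + v) - g x) at_top"
      using eventually_ge_at_top[of c]
    proof eventually_elim
      case (elim x)
      then show ?case
        using pos[of x] pos[of "x + v"] that
        by (simp add: g_def ln_div exp_add mult.commute)
    qed
    ultimately show ?thesis by (simp add: tendsto_cong)
  qed
  have "\<exists>x0\<ge>c. \<forall>x\<ge>x0. \<forall>u\<in>{0..a}. \<bar>g (x + u) - g x\<bar> \<le> \<epsilon>"
  proof (rule ccontr)
    assume "\<not> ?thesis"
    then have "\<forall>n. \<exists>x u. max c (real n) \<le> x \<and> u \<in> {0..a} \<and> \<epsilon> < \<bar>g (x + u) - g x\<bar>"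
      by (metis max.cobounded1 not_le)
    then obtain X u where X: "\<And>n. max c (real n) \<le> X n" and u: "\<And>n. u n \<in> {0..a}"
      and far: "\<And>n. \<epsilon> < \<bar>g (X n + u n) - g (X n)\<bar>"
      by metis
    define V where "V Y n = {v \<in> {0..2*a}. \<forall>m\<ge>n. \<bar>g (Y m + v) - g (Y m)\<bar> < \<epsilon> / 2}"
      for Y :: "nat \<Rightarrow> real" and n :: nat
    have V_sets [measurable]: "V Y n \<in> sets borel" for Y n
    proof -
      have [measurable]: "Measurable.pred borel (\<lambda>v. \<bar>g (Y m + v) - g (Y m)\<bar> < \<epsilon> / 2)" for m
        by measurable
      have "{v \<in> space borel. v \<in> {0..2*a} \<and> (\<forall>m. m \<ge> n \<longrightarrow> \<bar>g (Y m + v) - g (Y m)\<bar> < \<epsilon> / 2)} \<in> sets borel"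
        by measurable
      then show ?thesis by (simp add: V_def)
    qed
    have V_lim: "(\<lambda>n. measure lebesgue (V Y n)) \<longlonglongrightarrow> 2 * a" if Y: "\<And>n. real n \<le> Y n" for Y
    proof -
      have Y_lim: "filterlim Y at_top sequentially"
        by (rule filterlim_at_top_mono[OF filterlim_real_sequentially]) (use Y in \<open>intro always_eventually allI\<close>)
      have "v \<in> (\<Union>n. V Y n)" if v: "v \<in> {0..2*a}" for v
      proof -
        have "(\<lambda>m. g (Y m + v) - g (Y m)) \<longlonglongrightarrow> 0"
          using filterlim_compose[OF g_lim Y_lim] v by simp
        then have "eventually (\<lambda>m. \<bar>g (Y m + v) - g (Y m)\<bar> < \<epsilon> / 2) sequentially"
          using \<epsilon> by (auto dest!: tendstoD[of _ _ _ "\<epsilon> / 2"] simp: dist_real_def)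
        then show ?thesis using v by (auto simp: V_def eventually_sequentially)
      qed
      then have Un: "(\<Union>n. V Y n) = {0..2*a}" by (auto simp: V_def)
      have "(\<lambda>n. measure lebesgue (V Y n)) \<longlonglongrightarrow> measure lebesgue (\<Union>n. V Y n)"
      proof (rule Lim_measure_incseq)
        show "incseq (V Y)" by (auto simp: incseq_def V_def)
        show "emeasure lebesgue (\<Union>n. V Y n) \<noteq> \<infinity>" unfolding Un using a by simp
      qed auto
      then show ?thesis unfolding Un using a by simp
    qed
    \<comment> \<open>Each of the two sets fills more than three quarters of an interval of length \<open>2 * a\<close>.\<close>
    have "eventually (\<lambda>n. 3 / 2 * a < measure lebesgue (V X n)) sequentially"
    proof (intro order_tendstoD(1)[OF V_lim])
      show "real n \<le> X n" for n using X[of n] by simp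
    qed (use a in auto)
    moreover have "eventually (\<lambda>n. 3 / 2 * a < measure lebesgue (V (\<lambda>n. X n + u n) n)) sequentially"
    proof (intro order_tendstoD(1)[OF V_lim])
      show "real n \<le> X n + u n" for n using X[of n] u[of n] by auto
    qed (use a in auto)
    ultimately have "eventually (\<lambda>n. 3 / 2 * a < measure lebesgue (V X n) \<and>
        3 / 2 * a < measure lebesgue (V (\<lambda>n. X n + u n) n)) sequentially"
      by (rule eventually_conj)
    then obtain n where n: "3 / 2 * a < measure lebesgue (V X n)"
      "3 / 2 * a < measure lebesgue (V (\<lambda>n. X n + u n) n)"
      by (auto simp: eventually_sequentially)
    define S where "S = (+) (u n) ` V (\<lambda>n. X n + u n) n"
    have lm: "V Y n \<in> lmeasurable" for Y
      by (rule fmeasurableI2[of "{0..2*a}"]) (auto simp: V_def[of Y n])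
    have lmS: "S \<in> lmeasurable" unfolding S_def using lm by (rule measurable_translation)
    have mS: "measure lebesgue S = measure lebesgue (V (\<lambda>n. X n + u n) n)"
      unfolding S_def by (rule measure_translation)
    have "V X n \<inter> S \<noteq> {}"
    proof
      assume "V X n \<inter> S = {}"
      then have "measure lebesgue (V X n \<union> S) = measure lebesgue (V X n) + measure lebesgue S"
        using measure_Un3[OF lm[of X] lmS] by simp
      moreover have "V X n \<union> S \<subseteq> {0..3*a}"
        using u[of n] a by (auto simp: V_def S_def)
      then have "measure lebesgue (V X n \<union> S) \<le> measure lebesgue {0..3*a}"
        using lm lmS by (intro measure_mono_fmeasurable) auto
      ultimately show False using n mS a by auto
    qed
    then obtain w where "w \<in> V (\<lambda>n. X n + u n) n" "u n + w \<in> V X n" by (auto simp: S_def)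
    then have "\<bar>g (X n + u n + w) - g (X n + u n)\<bar> < \<epsilon> / 2" "\<bar>g (X n + (u n + w)) - g (X n)\<bar> < \<epsilon> / 2"
      by (auto simp: V_def)
    then show False using far[of n] unfolding add.assoc by linarith
  qed
  then obtain x0 where "x0 \<ge> c" "\<And>x u. x \<ge> x0 \<Longrightarrow> u \<in> {0..a} \<Longrightarrow> \<bar>g (x + u) - g x\<bar> \<le> \<epsilon>" by auto
  then show ?thesis
    using pos by (intro exI[of _ x0]) (fastforce simp: g_def)
qed

theorem slowly_varying_uniform:
  assumes sv: "slowly_varying L" and \<delta>: "0 < \<delta>"
  obtains x0 where "\<And>x t. x \<ge> x0 \<Longrightarrow> 1 \<le> t \<Longrightarrow> t \<le> A \<Longrightarrow>
    0 < L x \<and> 0 < L (t * x) \<and> \<bar>L x / L (t * x) - 1\<bar> \<le> \<delta>"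
proof -
  define a where "a = ln (max 2 A)"
  have a: "0 < a" by (simp add: a_def)
  have "0 < ln (1 + \<delta>)" using \<delta> by simp
  from slowly_varying_uniform_additive[OF sv a this]
  obtain y0 where "\<forall>x\<ge>y0. \<forall>u\<in>{0..a}. 0 < L (exp x) \<and> 0 < L (exp (x + u)) \<and>
    \<bar>ln (L (exp (x + u))) - ln (L (exp x))\<bar> \<le> ln (1 + \<delta>)" ..
  note y0 = this[rule_format]
  show ?thesis
  proof (rule that[of "exp y0"])
    fix x t assume x: "exp y0 \<le> x" and t: "1 \<le> t" "t \<le> A"
    have x0: "0 < x" by (rule order.strict_trans2[OF _ x]) simp
    have e: "exp (ln x) = x" "exp (ln x + ln t) = t * x" using x0 t by (auto simp: exp_add)
    have "y0 \<le> ln x" using x x0 by (simp add: ln_ge_iff)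
    moreover have "ln t \<in> {0..a}" using t by (auto simp: a_def)
    ultimately have *: "0 < L x" "0 < L (t * x)" "\<bar>ln (L (t * x)) - ln (L x)\<bar> \<le> ln (1 + \<delta>)"
      using y0[of "ln x" "ln t"] unfolding e by auto
    define r where "r = L x / L (t * x)"
    have r: "0 < r" using * by (simp add: r_def)
    have "ln r = ln (L x) - ln (L (t * x))" unfolding r_def using * by (simp add: ln_div)
    then have l: "ln r \<le> ln (1 + \<delta>)" "- ln (1 + \<delta>) \<le> ln r" using *(3) by auto
    have 1: "r \<le> 1 + \<delta>" using l(1) r \<delta> by simp
    have "ln (1 / (1 + \<delta>)) \<le> ln r" using l(2) \<delta> by (simp add: ln_div)
    then have "1 / (1 + \<delta>) \<le> r" using r \<delta> by simp
    moreover have "1 - \<delta> \<le> 1 / (1 + \<delta>)"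
      using \<delta> by (simp add: field_simps)
    ultimately show "0 < L x \<and> 0 < L (t * x) \<and> \<bar>L x / L (t * x) - 1\<bar> \<le> \<delta>"
      using * 1 unfolding r_def[symmetric] by auto
  qed
qed

section \<open>Generating function of the size of a BGW tree\<close>

definition weight :: "nat pmf \<Rightarrow> plane_tree \<Rightarrow> real" where
  "weight \<mu> t = (\<Prod>u\<in>set (vertices t). pmf \<mu> (out_degree t u))"

lemma weight_nonneg: "0 \<le> weight \<mu> t"
  by (simp add: weight_def prod_nonneg)

lemma set_vertices_Node:
  "set (vertices (Node ts)) = insert [] (\<Union>i<length ts. (#) i ` set (vertices (ts ! i)))"
  by (force simp: set_zip)

lemma out_degree_Node [simp]:
  "out_degree (Node ts) [] = length ts" "out_degree (Node ts) (i # u) = out_degree (ts ! i) u"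
  by (simp_all add: out_degree_def)

lemma num_vertices_Node: "num_vertices (Node ts) = Suc (\<Sum>t\<leftarrow>ts. num_vertices t)"
proof -
  have "num_vertices (Node ts) = Suc (card (\<Union>i<length ts. (#) i ` set (vertices (ts ! i))))"
    unfolding num_vertices_def set_vertices_Node by (subst card_insert_disjoint) auto
  also have "card (\<Union>i<length ts. (#) i ` set (vertices (ts ! i))) =
      (\<Sum>i<length ts. card ((#) i ` set (vertices (ts ! i))))"
    by (intro card_UN_disjoint) auto
  also have "\<dots> = (\<Sum>i<length ts. num_vertices (ts ! i))"
    by (intro sum.cong) (auto simp: num_vertices_def card_image inj_on_def)
  also have "\<dots> = (\<Sum>t\<leftarrow>ts. num_vertices t)"
    by (simp add: sum_list_sum_nth atLeast0LessThan)
  finally show ?thesis .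
qed

lemma weight_Node: "weight \<mu> (Node ts) = pmf \<mu> (length ts) * (\<Prod>t\<leftarrow>ts. weight \<mu> t)"
proof -
  have "weight \<mu> (Node ts) = pmf \<mu> (length ts) *
     (\<Prod>u\<in>(\<Union>i<length ts. (#) i ` set (vertices (ts ! i))). pmf \<mu> (out_degree (Node ts) u))"
    unfolding weight_def set_vertices_Node by (subst prod.insert) auto
  also have "(\<Prod>u\<in>(\<Union>i<length ts. (#) i ` set (vertices (ts ! i))). pmf \<mu> (out_degree (Node ts) u)) =
      (\<Prod>i<length ts. \<Prod>u\<in>(#) i ` set (vertices (ts ! i)). pmf \<mu> (out_degree (Node ts) u))"
    by (intro prod.UNION_disjoint) auto
  also have "\<dots> = (\<Prod>i<length ts. weight \<mu> (ts ! i))"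
    by (intro prod.cong) (auto simp: weight_def prod.reindex inj_on_def)
  also have "\<dots> = (\<Prod>t\<leftarrow>ts. weight \<mu> t)"
    by (simp add: prod.list_conv_set_nth atLeast0LessThan)
  finally show ?thesis .
qed

lemma num_vertices_pos: "0 < num_vertices t"
  by (cases t) (simp add: num_vertices_Node)

lemma nn_integral_lists_of_length:
  fixes e :: "'a \<Rightarrow> ennreal"
  shows "(\<integral>\<^sup>+ts. (if length ts = k then prod_list (map e ts) else 0) \<partial>count_space UNIV) =
    (\<integral>\<^sup>+t. e t \<partial>count_space UNIV) ^ k"
proof (induction k)
  case 0
  have "(\<integral>\<^sup>+ts. (if length ts = 0 then prod_list (map e ts) else 0) \<partial>count_space UNIV) =
    (\<integral>\<^sup>+ts. indicator {[]} ts \<partial>count_space (UNIV :: 'a list set))"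
    by (intro nn_integral_cong) (auto simp: indicator_def)
  then show ?case by simp
next
  case (Suc k)
  let ?f = "\<lambda>k ts. if length ts = k then prod_list (map e ts) else 0"
  have bij: "bij_betw (\<lambda>x. fst x # snd x) (UNIV :: ('a \<times> 'a list) set) {ts. ts \<noteq> []}"
    by (auto simp: bij_betw_def inj_on_def image_def neq_Nil_conv prod_eq_iff)
  have "(\<integral>\<^sup>+ts. ?f (Suc k) ts \<partial>count_space UNIV) = (\<integral>\<^sup>+ts. ?f (Suc k) ts \<partial>count_space {ts. ts \<noteq> []})"
    by (intro nn_integral_count_space_eq) auto
  also have "\<dots> = (\<integral>\<^sup>+x. ?f (Suc k) (fst x # snd x) \<partial>count_space UNIV)"
    using nn_integral_bij_count_space[OF bij, of "?f (Suc k)"] by simp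
  also have "\<dots> = (\<integral>\<^sup>+t. \<integral>\<^sup>+ts. ?f (Suc k) (t # ts) \<partial>count_space UNIV \<partial>count_space UNIV)"
    by (subst nn_integral_fst_count_space[symmetric]) (simp only: fst_conv snd_conv)
  also have "\<dots> = (\<integral>\<^sup>+t. e t * (\<integral>\<^sup>+ts. ?f k ts \<partial>count_space UNIV) \<partial>count_space UNIV)"
    by (intro nn_integral_cong, subst nn_integral_cmult[symmetric]) (auto intro!: nn_integral_cong)
  also have "\<dots> = (\<integral>\<^sup>+t. e t \<partial>count_space UNIV) * (\<integral>\<^sup>+t. e t \<partial>count_space UNIV) ^ k"
    unfolding Suc by (rule nn_integral_multc) simp
  finally show ?case by simp
qed

text \<open>The branching property: a tree is a list of trees, so summing a multiplicative weight over all trees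
  amounts to summing over the degree of the root.\<close>

lemma nn_integral_trees:
  fixes e :: "plane_tree \<Rightarrow> ennreal" and c :: "nat \<Rightarrow> ennreal"
  shows "(\<integral>\<^sup>+t. (case t of Node ts \<Rightarrow> c (length ts) * prod_list (map e ts)) \<partial>count_space UNIV) =
    (\<Sum>k. c k * (\<integral>\<^sup>+t. e t \<partial>count_space UNIV) ^ k)"
proof -
  have bij: "bij_betw Node UNIV UNIV"
    by (auto simp: bij_betw_def inj_on_def image_def intro: plane_tree.exhaust)
  have "(\<integral>\<^sup>+t. (case t of Node ts \<Rightarrow> c (length ts) * prod_list (map e ts)) \<partial>count_space UNIV) =
    (\<integral>\<^sup>+ts. c (length ts) * prod_list (map e ts) \<partial>count_space UNIV)"
    by (subst nn_integral_bij_count_space[OF bij, symmetric]) simp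
  also have "\<dots> = (\<integral>\<^sup>+ts. (\<Sum>k. c k * (if length ts = k then prod_list (map e ts) else 0)) \<partial>count_space UNIV)"
  proof (intro nn_integral_cong)
    fix ts :: "plane_tree list"
    show "c (length ts) * prod_list (map e ts) = (\<Sum>k. c k * (if length ts = k then prod_list (map e ts) else 0))"
      by (subst suminf_finite[of "{length ts}"]) auto
  qed
  also have "\<dots> = (\<Sum>k. \<integral>\<^sup>+ts. c k * (if length ts = k then prod_list (map e ts) else 0) \<partial>count_space UNIV)"
    by (rule nn_integral_suminf) simp
  also have "\<dots> = (\<Sum>k. c k * (\<integral>\<^sup>+t. e t \<partial>count_space UNIV) ^ k)"
    by (subst nn_integral_cmult) (auto simp: nn_integral_lists_of_length)
  finally show ?thesis .
qed

definition size_gf :: "nat pmf \<Rightarrow> real \<Rightarrow> ennreal" where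
  "size_gf \<mu> s = (\<integral>\<^sup>+t. ennreal (weight \<mu> t * s ^ num_vertices t) \<partial>count_space UNIV)"

lemma weight_term_Node:
  assumes "0 \<le> s"
  shows "ennreal (weight \<mu> (Node ts) * s ^ num_vertices (Node ts)) =
    ennreal (s * pmf \<mu> (length ts)) * (\<Prod>t\<leftarrow>ts. ennreal (weight \<mu> t * s ^ num_vertices t))"
proof -
  have *: "(\<Prod>t\<leftarrow>ts. ennreal (weight \<mu> t * s ^ num_vertices t)) =
      ennreal ((\<Prod>t\<leftarrow>ts. weight \<mu> t) * s ^ (\<Sum>t\<leftarrow>ts. num_vertices t))"
  proof (induction ts)
    case (Cons t ts)
    have "0 \<le> (\<Prod>t\<leftarrow>ts. weight \<mu> t)" by (induction ts) (auto simp: weight_nonneg)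
    with Cons assms show ?case
      by (simp add: ennreal_mult[symmetric] weight_nonneg power_add mult_ac)
  qed simp
  have "0 \<le> (\<Prod>t\<leftarrow>ts. weight \<mu> t)" by (induction ts) (auto simp: weight_nonneg)
  then show ?thesis
    using assms unfolding * by (simp add: ennreal_mult[symmetric] weight_Node num_vertices_Node mult_ac)
qed

lemma size_gf_recursion:
  assumes "0 \<le> s"
  shows "size_gf \<mu> s = (\<Sum>k. ennreal (s * pmf \<mu> k) * size_gf \<mu> s ^ k)"
proof -
  have "size_gf \<mu> s = (\<integral>\<^sup>+t. (case t of Node ts \<Rightarrow> ennreal (s * pmf \<mu> (length ts)) *
      prod_list (map (\<lambda>t. ennreal (weight \<mu> t * s ^ num_vertices t)) ts)) \<partial>count_space UNIV)"
    unfolding size_gf_def using assms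
    by (intro nn_integral_cong) (auto simp: weight_term_Node split: plane_tree.split)
  also have "\<dots> = (\<Sum>k. ennreal (s * pmf \<mu> k) * size_gf \<mu> s ^ k)"
    unfolding size_gf_def by (rule nn_integral_trees)
  finally show ?thesis .
qed

lemma suminf_ennreal_pmf: "(\<Sum>k. ennreal (pmf \<mu> k)) = 1" for \<mu> :: "nat pmf"
  using nn_integral_pmf[of UNIV \<mu>] by (simp add: nn_integral_count_space_nat)

text \<open>The recursion alone does not exclude an infinite value. Restricted to trees with at most \<open>h\<close> vertices
  the sum is at most \<open>1\<close> by induction on \<open>h\<close>, as the subtrees at the children of the root are smaller.\<close>

lemma size_gf_le_1:
  assumes s: "0 \<le> s" "s \<le> 1"
  shows "size_gf \<mu> s \<le> 1"
proof -
  define e where "e h t = ennreal (weight \<mu> t * s ^ num_vertices t) * indicator {t. num_vertices t \<le> h} t" for h t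
  have "(\<integral>\<^sup>+t. e h t \<partial>count_space UNIV) \<le> 1" for h
  proof (induction h)
    case 0
    have "e 0 = (\<lambda>t. 0)" using num_vertices_pos by (auto simp: e_def fun_eq_iff)
    then show ?case by simp
  next
    case (Suc h)
    have "e (Suc h) t \<le> (case t of Node ts \<Rightarrow> ennreal (pmf \<mu> (length ts)) * prod_list (map (e h) ts))" for t
    proof (cases t)
      case (Node ts)
      show ?thesis
      proof (cases "num_vertices t \<le> Suc h")
        case True
        have "num_vertices x \<le> h" if "x \<in> set ts" for x
          using member_le_sum_list[of "num_vertices x" "map num_vertices ts"] that True Node
          by (auto simp: num_vertices_Node)
        then have "map (e h) ts = map (\<lambda>t. ennreal (weight \<mu> t * s ^ num_vertices t)) ts"
          by (intro map_cong) (auto simp: e_def)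
        then have "prod_list (map (e h) ts) = (\<Prod>t\<leftarrow>ts. ennreal (weight \<mu> t * s ^ num_vertices t))"
          by (rule arg_cong)
        moreover have "ennreal (s * pmf \<mu> (length ts)) \<le> ennreal (pmf \<mu> (length ts))"
          using s by (intro ennreal_leI mult_left_le_one_le) auto
        ultimately show ?thesis
          using True Node weight_term_Node[OF s(1), of \<mu> ts] by (simp add: e_def mult_right_mono)
      qed (simp add: e_def)
    qed
    then have "(\<integral>\<^sup>+t. e (Suc h) t \<partial>count_space UNIV) \<le>
      (\<integral>\<^sup>+t. (case t of Node ts \<Rightarrow> ennreal (pmf \<mu> (length ts)) * prod_list (map (e h) ts)) \<partial>count_space UNIV)"
      by (intro nn_integral_mono)
    also have "\<dots> = (\<Sum>k. ennreal (pmf \<mu> k) * (\<integral>\<^sup>+t. e h t \<partial>count_space UNIV) ^ k)"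
      by (rule nn_integral_trees)
    also have "\<dots> \<le> (\<Sum>k. ennreal (pmf \<mu> k) * 1 ^ k)"
      using Suc by (intro suminf_le mult_left_mono power_mono) auto
    also have "\<dots> = 1" using suminf_ennreal_pmf by simp
    finally show ?case .
  qed
  moreover have "size_gf \<mu> s = (SUP h. \<integral>\<^sup>+t. e h t \<partial>count_space UNIV)"
  proof -
    have "ennreal (weight \<mu> t * s ^ num_vertices t) = (SUP h. e h t)" for t
    proof (rule antisym)
      show "ennreal (weight \<mu> t * s ^ num_vertices t) \<le> (SUP h. e h t)"
        by (rule SUP_upper2[of "num_vertices t"]) (auto simp: e_def)
      show "(SUP h. e h t) \<le> ennreal (weight \<mu> t * s ^ num_vertices t)"
        by (rule SUP_least) (auto simp: e_def indicator_def)
    qed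
    moreover have "incseq e"
      by (auto simp: incseq_def le_fun_def e_def indicator_def)
    ultimately show ?thesis
      unfolding size_gf_def by (simp add: nn_integral_monotone_convergence_SUP)
  qed
  ultimately show ?thesis by (simp add: SUP_least)
qed

lemma sets_BGW [simp, measurable_cong]: "sets (BGW \<mu>) = UNIV" and space_BGW [simp]: "space (BGW \<mu>) = UNIV"
  by (simp_all add: BGW_def)

lemma emeasure_BGW: "emeasure (BGW \<mu>) A = (\<integral>\<^sup>+t. ennreal (weight \<mu> t) * indicator A t \<partial>count_space UNIV)"
  by (simp add: BGW_def weight_def emeasure_density)

lemma size_gf_eq_suminf:
  assumes "0 \<le> s"
  shows "size_gf \<mu> s = (\<Sum>n. emeasure (BGW \<mu>) {t. num_vertices t = n} * ennreal (s ^ n))"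
proof -
  have "size_gf \<mu> s = (\<integral>\<^sup>+t. (\<Sum>n. ennreal (weight \<mu> t) * indicator {t. num_vertices t = n} t * ennreal (s ^ n))
       \<partial>count_space UNIV)"
    unfolding size_gf_def
  proof (intro nn_integral_cong)
    fix t
    show "ennreal (weight \<mu> t * s ^ num_vertices t) =
      (\<Sum>n. ennreal (weight \<mu> t) * indicator {t. num_vertices t = n} t * ennreal (s ^ n))"
      using assms by (subst suminf_finite[of "{num_vertices t}"]) (auto simp: ennreal_mult weight_nonneg)
  qed
  also have "\<dots> = (\<Sum>n. \<integral>\<^sup>+t. ennreal (weight \<mu> t) * indicator {t. num_vertices t = n} t * ennreal (s ^ n)
       \<partial>count_space UNIV)"
    by (rule nn_integral_suminf) simp
  also have "\<dots> = (\<Sum>n. emeasure (BGW \<mu>) {t. num_vertices t = n} * ennreal (s ^ n))"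
    by (simp add: emeasure_BGW nn_integral_multc)
  finally show ?thesis .
qed

lemma pmf_sums: "pmf \<mu> sums 1" for \<mu> :: "nat pmf"
proof -
  have "(\<lambda>k. ennreal (pmf \<mu> k)) sums (\<Sum>k. ennreal (pmf \<mu> k))" by (simp add: summable_sums)
  then have "(\<lambda>k. ennreal (pmf \<mu> k)) sums ennreal 1" by (simp add: suminf_ennreal_pmf)
  then show ?thesis by (subst (asm) sums_ennreal) auto
qed

lemma prob_greaterThan: "measure_pmf.prob \<mu> {n<..} = 1 - (\<Sum>k\<le>n. pmf \<mu> k)" for \<mu> :: "nat pmf"
proof -
  have "{n<..} = space (measure_pmf \<mu>) - {..n}" by auto
  then show ?thesis
    using measure_pmf.prob_compl[of "{..n}" \<mu>] by (simp add: measure_measure_pmf_finite)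
qed

lemma sums_prob_greaterThan:
  fixes \<mu> :: "nat pmf"
  assumes "(\<lambda>i. real i * pmf \<mu> i) sums m"
  shows "(\<lambda>n. measure_pmf.prob \<mu> {n<..}) sums m"
proof -
  have m: "0 \<le> m" using assms sums_le[of "\<lambda>_. 0" "\<lambda>i. real i * pmf \<mu> i" 0 m] by auto
  have "(\<integral>\<^sup>+x. ennreal_of_enat (enat x) \<partial>measure_pmf \<mu>) = (\<integral>\<^sup>+x. ennreal (real x) \<partial>measure_pmf \<mu>)"
    by (intro nn_integral_cong) (simp add: ennreal_of_nat_eq_real_of_nat)
  also have "\<dots> = (\<Sum>i. ennreal (real i * pmf \<mu> i))"
    by (simp add: nn_integral_measure_pmf nn_integral_count_space_nat ennreal_mult mult.commute)
  also have "\<dots> = ennreal m"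
    using assms by (intro sums_unique[symmetric]) (simp add: sums_ennreal m)
  also have "(\<integral>\<^sup>+x. ennreal_of_enat (enat x) \<partial>measure_pmf \<mu>) =
      (\<Sum>t. emeasure (measure_pmf \<mu>) {x. t < x})"
    by (subst nn_integral_enat_function) auto
  also have "\<dots> = (\<Sum>n. ennreal (measure_pmf.prob \<mu> {n<..}))"
    by (simp add: measure_pmf.emeasure_eq_measure greaterThan_def)
  finally have "(\<Sum>n. ennreal (measure_pmf.prob \<mu> {n<..})) = ennreal m" .
  then have "(\<lambda>n. ennreal (measure_pmf.prob \<mu> {n<..})) sums ennreal m"
    by (metis summable_sums summableI)
  then show ?thesis by (subst (asm) sums_ennreal) (auto simp: m)
qed

lemma
  fixes \<mu> :: "nat pmf"
  assumes sv: "slowly_varying L"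
    and asym: "(\<lambda>n. measure_pmf.prob \<mu> {n..}) \<sim>[sequentially] (\<lambda>n. L (real n) / real n)"
  shows prob_atLeast_pos: "0 < measure_pmf.prob \<mu> {n..}"
    and prob_atLeast_halving: "(\<lambda>n. measure_pmf.prob \<mu> {2 * n..} / measure_pmf.prob \<mu> {n..}) \<longlonglongrightarrow> 1 / 2"
proof -
  define B where "B n = measure_pmf.prob \<mu> {n..}" for n
  have evL: "eventually (\<lambda>n::nat. 0 < L (real n)) sequentially"
  proof -
    obtain a where "\<And>x. x \<ge> a \<Longrightarrow> L x > 0" using sv unfolding slowly_varying_def by auto
    then have "eventually (\<lambda>x. 0 < L x) at_top" by (auto simp: eventually_at_top_linorder)
    then show ?thesis by (rule eventually_compose_filterlim[OF _ filterlim_real_sequentially])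
  qed
  define r where "r n = B n / (L (real n) / real n)" for n
  have r: "r \<longlonglongrightarrow> 1"
    unfolding r_def [abs_def] B_def
  proof (rule asymp_equivD_strong[OF asym])
    show "eventually (\<lambda>n. measure_pmf.prob \<mu> {n..} \<noteq> 0 \<or> L (real n) / real n \<noteq> 0) sequentially"
      using evL eventually_gt_at_top[of 0] by eventually_elim auto
  qed
  have dec: "B n \<le> B m" if "m \<le> n" for m n
    using that unfolding B_def by (intro measure_pmf.finite_measure_mono) auto
  have "eventually (\<lambda>n. 0 < r n) sequentially" using r by (rule order_tendstoD) simp
  then have "eventually (\<lambda>n. 0 < B n) sequentially"
    using evL eventually_gt_at_top[of 0]
    by eventually_elim (auto simp: r_def zero_less_divide_iff zero_less_mult_iff)
  then obtain M where M: "\<And>n. n \<ge> M \<Longrightarrow> 0 < B n" by (auto simp: eventually_sequentially)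
  have Bpos: "0 < B n" for n
    using M[of "max n M"] dec[of n "max n M"] by simp
  then show "0 < measure_pmf.prob \<mu> {n..}" by (simp add: B_def)
  have dbl: "filterlim (\<lambda>n::nat. 2 * n) sequentially sequentially"
    by (rule filterlim_at_top_mono[OF filterlim_ident]) auto
  have L2: "(\<lambda>n. L (2 * real n) / L (real n)) \<longlonglongrightarrow> 1"
    using sv unfolding slowly_varying_def
    by (intro filterlim_compose[OF _ filterlim_real_sequentially]) auto
  have "(\<lambda>n. r (2 * n) / r n * (L (2 * real n) / L (real n)) * (1 / 2)) \<longlonglongrightarrow> 1 / 1 * 1 * (1 / 2)"
    by (intro tendsto_intros r L2 filterlim_compose[OF r dbl]) auto
  moreover have "eventually (\<lambda>n. r (2 * n) / r n * (L (2 * real n) / L (real n)) * (1 / 2) = B (2 * n) / B n) sequentially"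
    using evL eventually_compose_filterlim[OF evL dbl] eventually_gt_at_top[of 0]
  proof eventually_elim
    case (elim n)
    then show ?case using Bpos[of n] by (simp add: r_def field_simps)
  qed
  ultimately show "(\<lambda>n. measure_pmf.prob \<mu> {2 * n..} / measure_pmf.prob \<mu> {n..}) \<longlonglongrightarrow> 1 / 2"
    by (simp add: tendsto_cong B_def)
qed

lemma halving_tail_pmf:
  fixes \<mu> :: "nat pmf"
  assumes sv: "slowly_varying L"
    and mean: "(\<lambda>i. real i * pmf \<mu> i) sums 1"
    and asym: "(\<lambda>n. measure_pmf.prob \<mu> {n..}) \<sim>[sequentially] (\<lambda>n. L (real n) / real n)"
  shows "halving_tail (\<lambda>n. measure_pmf.prob \<mu> {n<..})"
proof
  have Suc: "{n<..} = {Suc n..}" for n by auto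
  show "measure_pmf.prob \<mu> {n<..} \<le> measure_pmf.prob \<mu> {m<..}" if "m \<le> n" for m n
    using that by (intro measure_pmf.finite_measure_mono) auto
  show "0 < measure_pmf.prob \<mu> {n<..}" for n
    unfolding Suc by (rule prob_atLeast_pos[OF sv asym])
  show "(\<lambda>n. measure_pmf.prob \<mu> {n<..}) sums 1" by (rule sums_prob_greaterThan[OF mean])
  show "(\<lambda>n. measure_pmf.prob \<mu> {2 * n + 1<..} / measure_pmf.prob \<mu> {n<..}) \<longlonglongrightarrow> 1 / 2"
    using filterlim_compose[OF prob_atLeast_halving[OF sv asym] filterlim_Suc] unfolding Suc by simp
qed

lemma pgf_eq_tail:
  fixes \<mu> :: "nat pmf"
  assumes "0 \<le> y" "y < 1"
  shows "gf (pmf \<mu>) y = 1 - (1 - y) * gf (\<lambda>n. measure_pmf.prob \<mu> {n<..}) y"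
  unfolding prob_greaterThan using assms by (intro gf_eq_tail_gf pmf_sums) auto

lemma finite_measure_BGW: "finite_measure (BGW \<mu>)"
proof
  have "emeasure (BGW \<mu>) UNIV = size_gf \<mu> 1" by (simp add: emeasure_BGW size_gf_def)
  also have "\<dots> \<le> 1" by (rule size_gf_le_1) auto
  finally show "emeasure (BGW \<mu>) (space (BGW \<mu>)) \<noteq> \<infinity>" by (auto simp: top_unique)
qed

definition size_prob :: "nat pmf \<Rightarrow> nat \<Rightarrow> real" where
  "size_prob \<mu> n = measure (BGW \<mu>) {t. num_vertices t = n}"

lemma size_gf_real:
  assumes s: "0 \<le> s" "s \<le> 1"
  shows "size_gf \<mu> s = ennreal (gf (size_prob \<mu>) s)"
    and "summable (\<lambda>n. size_prob \<mu> n * s ^ n)"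
    and "0 \<le> gf (size_prob \<mu>) s" "gf (size_prob \<mu>) s \<le> 1"
    and "gf (size_prob \<mu>) s = s * gf (pmf \<mu>) (gf (size_prob \<mu>) s)"
proof -
  interpret finite_measure "BGW \<mu>" by (rule finite_measure_BGW)
  have eq: "size_gf \<mu> s = (\<Sum>n. ennreal (size_prob \<mu> n * s ^ n))"
    using s by (simp add: size_gf_eq_suminf emeasure_eq_measure size_prob_def ennreal_mult)
  have fin: "(\<Sum>n. ennreal (size_prob \<mu> n * s ^ n)) \<noteq> top"
    using size_gf_le_1[OF s, of \<mu>] unfolding eq by (auto simp: top_unique)
  have nn: "0 \<le> size_prob \<mu> n * s ^ n" for n using s by (simp add: size_prob_def)
  show sm: "summable (\<lambda>n. size_prob \<mu> n * s ^ n)" using nn fin by (rule summable_suminf_not_top)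
  show F: "size_gf \<mu> s = ennreal (gf (size_prob \<mu>) s)"
    unfolding eq gf_def using nn fin by (intro suminf_ennreal)
  show F0: "0 \<le> gf (size_prob \<mu>) s" unfolding gf_def using nn sm by (intro suminf_nonneg)
  show F1: "gf (size_prob \<mu>) s \<le> 1" using size_gf_le_1[OF s, of \<mu>] F F0 by simp
  have "summable (\<lambda>k. pmf \<mu> k * gf (size_prob \<mu>) s ^ k)"
  proof (rule summable_comparison_test')
    show "summable (pmf \<mu>)" using pmf_sums by (rule sums_summable)
    show "norm (pmf \<mu> k * gf (size_prob \<mu>) s ^ k) \<le> pmf \<mu> k" for k
      using power_le_one[OF F0 F1, of k] F0 by (simp add: abs_mult mult_left_le)
  qed
  then have S: "(\<lambda>k. s * (pmf \<mu> k * gf (size_prob \<mu>) s ^ k)) sums (s * gf (pmf \<mu>) (gf (size_prob \<mu>) s))"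
    unfolding gf_def[of "pmf \<mu>"] by (intro sums_mult summable_sums)
  have nn': "0 \<le> s * (pmf \<mu> k * gf (size_prob \<mu>) s ^ k)" for k
    using s F0 by simp
  have G0: "0 \<le> s * gf (pmf \<mu>) (gf (size_prob \<mu>) s)"
    by (rule sums_le[OF nn' sums_zero S])
  have "ennreal (s * pmf \<mu> k) * size_gf \<mu> s ^ k = ennreal (s * (pmf \<mu> k * gf (size_prob \<mu>) s ^ k))" for k
    unfolding F ennreal_power[OF F0]
    by (subst ennreal_mult[symmetric]) (use s F0 in \<open>simp_all add: mult.assoc\<close>)
  then have "(\<Sum>k. ennreal (s * pmf \<mu> k) * size_gf \<mu> s ^ k) =
      (\<Sum>k. ennreal (s * (pmf \<mu> k * gf (size_prob \<mu>) s ^ k)))"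
    by (intro suminf_cong)
  also have "\<dots> = ennreal (s * gf (pmf \<mu>) (gf (size_prob \<mu>) s))"
    using S by (intro sums_unique[symmetric]) (subst sums_ennreal[OF nn' G0])
  finally have "(\<Sum>k. ennreal (s * pmf \<mu> k) * size_gf \<mu> s ^ k) = ennreal (s * gf (pmf \<mu>) (gf (size_prob \<mu>) s))" .
  then have "ennreal (gf (size_prob \<mu>) s) = ennreal (s * gf (pmf \<mu>) (gf (size_prob \<mu>) s))"
    using size_gf_recursion[OF s(1), of \<mu>] F by simp
  then show "gf (size_prob \<mu>) s = s * gf (pmf \<mu>) (gf (size_prob \<mu>) s)"
    using F0 G0 by (simp only: ennreal_inj)
qed

text \<open>The total mass \<open>m\<close> is a fixed point of the offspring generating function, that is,
  \<open>1 - m = (1 - m) * T m\<close>; and \<open>T m < 1\<close> for \<open>m < 1\<close>, so the tree is almost surely finite.\<close>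

lemma size_prob_sums_1:
  assumes "halving_tail (\<lambda>n. measure_pmf.prob \<mu> {n<..})"
  shows "size_prob \<mu> sums 1"
proof -
  interpret halving_tail "\<lambda>n. measure_pmf.prob \<mu> {n<..}" by fact
  define m where "m = gf (size_prob \<mu>) 1"
  have m: "0 \<le> m" "m \<le> 1" "m = gf (pmf \<mu>) m"
    using size_gf_real(3-5)[of 1 \<mu>] by (auto simp: m_def)
  have "m = 1"
  proof (rule ccontr)
    assume "m \<noteq> 1"
    with m have m1: "m < 1" by simp
    then have "(1 - m) * T m = 1 - m" using pgf_eq_tail[OF m(1) m1, of \<mu>] m(3) by linarith
    then have "T m = 1" using m1 by simp
    then show False using T_less_1[OF m(1) m1] by simp
  qed
  then show ?thesis using size_gf_real(2)[of 1 \<mu>] by (simp add: m_def gf_def sums_iff)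
qed

lemma prob_space_BGW:
  assumes "halving_tail (\<lambda>n. measure_pmf.prob \<mu> {n<..})"
  shows "prob_space (BGW \<mu>)"
proof
  have "emeasure (BGW \<mu>) UNIV = size_gf \<mu> 1" by (simp add: emeasure_BGW size_gf_def)
  also have "\<dots> = 1"
    using size_prob_sums_1[OF assms] size_gf_real(1)[of 1 \<mu>] by (simp add: gf_def sums_iff)
  finally show "emeasure (BGW \<mu>) (space (BGW \<mu>)) = 1" by simp
qed

lemma size_tail_eq:
  assumes "prob_space (BGW \<mu>)"
  shows "measure (BGW \<mu>) {t. n < num_vertices t} = 1 - (\<Sum>k\<le>n. size_prob \<mu> k)"
proof -
  interpret prob_space "BGW \<mu>" by fact
  have "measure (BGW \<mu>) (\<Union>k\<le>n. {t. num_vertices t = k}) = (\<Sum>k\<le>n. size_prob \<mu> k)"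
    unfolding size_prob_def
    by (intro finite_measure_finite_Union) (auto simp: disjoint_family_on_def)
  moreover have "{t. n < num_vertices t} = space (BGW \<mu>) - (\<Union>k\<le>n. {t. num_vertices t = k})" by auto
  then have "measure (BGW \<mu>) {t. n < num_vertices t} = 1 - measure (BGW \<mu>) (\<Union>k\<le>n. {t. num_vertices t = k})"
    using prob_compl[of "\<Union>k\<le>n. {t. num_vertices t = k}"] by simp
  ultimately show ?thesis by simp
qed

theorem BGW_size_tail_ratio:
  fixes \<mu> :: "nat pmf"
  assumes ht: "halving_tail (\<lambda>n. measure_pmf.prob \<mu> {n<..})" and \<epsilon>: "0 < \<epsilon>"
  obtains A n0 where "A > 0" "\<And>n. n \<ge> n0 \<Longrightarrow>
    measure (BGW \<mu>) {t. A * n < num_vertices t} \<le> \<epsilon> * measure (BGW \<mu>) {t. n < num_vertices t}"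
proof -
  interpret prob_space "BGW \<mu>" by (rule prob_space_BGW[OF ht])
  interpret halving_tail "\<lambda>n. measure_pmf.prob \<mu> {n<..}" by fact
  interpret critical_recursion "\<lambda>n. measure_pmf.prob \<mu> {n<..}" "\<lambda>n. measure (BGW \<mu>) {t. n < num_vertices t}"
  proof
    show "measure (BGW \<mu>) {t. n < num_vertices t} \<le> measure (BGW \<mu>) {t. m < num_vertices t}" if "m \<le> n" for m n
      using that by (intro finite_measure_mono) auto
    fix s y assume s: "0 \<le> s" "s < 1"
      and y: "y = 1 - (1 - s) * gf (\<lambda>n. measure (BGW \<mu>) {t. n < num_vertices t}) s"
    have y_eq: "y = gf (size_prob \<mu>) s"
      using gf_eq_tail_gf[of "size_prob \<mu>" s] size_prob_sums_1[OF ht] s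
      by (simp add: y size_tail_eq[OF prob_space_axioms] size_prob_def)
    have y1: "0 \<le> y" "y \<le> 1" "y = s * gf (pmf \<mu>) y"
      using size_gf_real(3-5)[of s \<mu>] s by (auto simp: y_eq)
    show "y = s * (1 - (1 - y) * T y)"
    proof (cases "y = 1")
      case True
      have "gf (pmf \<mu>) 1 = 1" using pmf_sums[of \<mu>] by (simp add: gf_def sums_iff)
      then show ?thesis using True y1 by simp
    next
      case False
      then show ?thesis using y1 pgf_eq_tail[of y \<mu>] by simp
    qed
  qed auto
  show ?thesis using tail_ratio_small[OF \<epsilon>] that by metis
qed

section \<open>Conditioning on a large size\<close>

lemma cdf_distr_uniform_measure:
  fixes X :: "'a \<Rightarrow> real"
  assumes "prob_space M" and X: "X \<in> borel_measurable M"
    and A: "A \<in> sets M" "0 < measure M A"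
  shows "cdf (distr (uniform_measure M A) borel X) z = measure M (A \<inter> {x \<in> space M. X x \<le> z}) / measure M A"
proof -
  interpret prob_space M by fact
  have e: "emeasure M A \<noteq> 0" "emeasure M A \<noteq> \<infinity>"
    using A by (auto simp: emeasure_eq_measure)
  have "cdf (distr (uniform_measure M A) borel X) z = measure (uniform_measure M A) (X -` {..z} \<inter> space M)"
    unfolding cdf_def using X by (subst measure_distr) auto
  also have "X -` {..z} \<inter> space M = {x \<in> space M. X x \<le> z}" by auto
  also have "measure (uniform_measure M A) {x \<in> space M. X x \<le> z} = measure M (A \<inter> {x \<in> space M. X x \<le> z}) / measure M A"
    using X by (intro measure_uniform_measure e) measurable
  finally show ?thesis .
qed

text \<open>The law given \<open>N \<ge> n\<close> is an average of the laws given \<open>N = k\<close>, in which the values \<open>k > m\<close> have total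
  weight at most \<open>b\<close>. Conditional probabilities are written without denominators, which covers the
  values \<open>k\<close> of probability zero.\<close>

lemma (in prob_space) mixture_bound:
  fixes N :: "'a \<Rightarrow> nat" and m :: nat
  assumes N: "N \<in> measurable M (count_space UNIV)" and E: "E \<in> events"
    and mid: "\<And>k. n \<le> k \<Longrightarrow> k \<le> m \<Longrightarrow>
      \<bar>prob ({x \<in> space M. N x = k} \<inter> E) - prob {x \<in> space M. N x = k} * p\<bar> \<le> a * prob {x \<in> space M. N x = k}"
    and p: "0 \<le> p" "p \<le> 1" and nm: "n \<le> m" and a: "0 \<le> a"
    and tail: "prob {x \<in> space M. m < N x} \<le> b * prob {x \<in> space M. n \<le> N x}"
  shows "\<bar>prob ({x \<in> space M. n \<le> N x} \<inter> E) - prob {x \<in> space M. n \<le> N x} * p\<bar>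
    \<le> (a + b) * prob {x \<in> space M. n \<le> N x}"
proof -
  note [measurable] = N E
  define S where "S k = {x \<in> space M. N x = k}" for k
  define R where "R = {x \<in> space M. m < N x}"
  have [measurable]: "S k \<in> events" "R \<in> events" for k
    unfolding S_def R_def by measurable
  have split: "prob ({x \<in> space M. n \<le> N x} \<inter> D) = (\<Sum>k\<in>{n..m}. prob (S k \<inter> D)) + prob (R \<inter> D)"
    if [measurable]: "D \<in> events" for D
  proof -
    have "{x \<in> space M. n \<le> N x} \<inter> D = (\<Union>k\<in>{n..m}. S k \<inter> D) \<union> (R \<inter> D)"
      using nm by (auto simp: S_def R_def)
    moreover have "prob ((\<Union>k\<in>{n..m}. S k \<inter> D) \<union> (R \<inter> D)) = prob (\<Union>k\<in>{n..m}. S k \<inter> D) + prob (R \<inter> D)"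
      by (intro finite_measure_Union) (auto simp: S_def R_def)
    moreover have "prob (\<Union>k\<in>{n..m}. S k \<inter> D) = (\<Sum>k\<in>{n..m}. prob (S k \<inter> D))"
      by (intro finite_measure_finite_Union) (auto simp: S_def disjoint_family_on_def)
    ultimately show ?thesis by simp
  qed
  have spS: "S k \<inter> space M = S k" "R \<inter> space M = R" "{x \<in> space M. n \<le> N x} \<inter> space M = {x \<in> space M. n \<le> N x}" for k
    by (auto simp: S_def R_def)
  have tot: "prob {x \<in> space M. n \<le> N x} = (\<Sum>k\<in>{n..m}. prob (S k)) + prob R"
    using split[of "space M"] by (simp add: spS)
  have "prob ({x \<in> space M. n \<le> N x} \<inter> E) - prob {x \<in> space M. n \<le> N x} * p =
      (\<Sum>k\<in>{n..m}. prob (S k \<inter> E) - prob (S k) * p) + (prob (R \<inter> E) - prob R * p)"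
    unfolding tot split[OF E] by (simp add: algebra_simps sum_subtractf sum_distrib_left)
  moreover have "\<bar>\<Sum>k\<in>{n..m}. prob (S k \<inter> E) - prob (S k) * p\<bar> \<le> (\<Sum>k\<in>{n..m}. a * prob (S k))"
    using mid by (intro order.trans[OF sum_abs] sum_mono) (auto simp: S_def)
  moreover have "(\<Sum>k\<in>{n..m}. a * prob (S k)) \<le> a * prob {x \<in> space M. n \<le> N x}"
    unfolding tot using a by (simp add: sum_distrib_left algebra_simps)
  moreover have "\<bar>prob (R \<inter> E) - prob R * p\<bar> \<le> prob R"
  proof -
    have "prob (R \<inter> E) \<le> prob R" by (intro finite_measure_mono) auto
    moreover have "0 \<le> prob R * p" "prob R * p \<le> prob R" using p by (auto intro: mult_left_le)
    ultimately show ?thesis using measure_nonneg[of M "R \<inter> E"] by linarith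
  qed
  moreover have "prob R \<le> b * prob {x \<in> space M. n \<le> N x}" using tail by (simp add: R_def)
  ultimately show ?thesis unfolding distrib_right by linarith
qed

lemma isCont_cdf_Exp_law: "isCont (cdf (Exp_law 1)) z"
  and prob_space_Exp_law: "prob_space (Exp_law 1)"
proof -
  show ps: "prob_space (Exp_law 1)"
    unfolding Exp_law_def by (rule prob_space_exponential_density) simp
  interpret prob_space "Exp_law 1" by fact
  interpret real_distribution "Exp_law 1"
    by unfold_locales (simp_all add: Exp_law_def)
  have "emeasure (Exp_law 1) {z} = 0"
    unfolding Exp_law_def by (subst emeasure_density) (auto intro!: nn_integral_null_set)
  then show "isCont (cdf (Exp_law 1)) z" by (subst isCont_cdf) (simp add: measure_def)
qed

text \<open>For \<open>n \<le> k \<le> A * n\<close> the event \<open>X \<le> z * \<Lambda> n\<close> is \<open>X \<le> (z * \<rho>) * \<Lambda> k\<close> with \<open>\<rho> = \<Lambda> n / \<Lambda> k\<close> close to \<open>1\<close>. It lies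
  between the events with \<open>z - \<eta>\<close> and \<open>z + \<eta>\<close> in place of \<open>z * \<rho>\<close>, whose conditional probabilities given
  \<open>N = k\<close> are close to \<open>cdf D z\<close> by convergence at these two fixed points and continuity of \<open>cdf D\<close>.\<close>

theorem weak_conv_condition_ge:
  fixes N :: "'a \<Rightarrow> nat" and X :: "'a \<Rightarrow> real" and \<Lambda> :: "real \<Rightarrow> real" and D :: "real measure"
  assumes M: "prob_space M"
    and N [measurable]: "N \<in> measurable M (count_space UNIV)"
    and X [measurable]: "X \<in> borel_measurable M"
    and D: "prob_space D" "sets D = sets borel" "\<And>z. isCont (cdf D) z"
    and sv: "slowly_varying \<Lambda>"
    and inf: "infinite {k. 0 < measure M {x \<in> space M. N x = k}}"
    and tails: "\<And>\<epsilon>. 0 < \<epsilon> \<Longrightarrow> \<exists>A>0. \<exists>n0. \<forall>n\<ge>n0. measure M {x \<in> space M. A * n < N x}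
        \<le> \<epsilon> * measure M {x \<in> space M. n < N x}"
    and conv: "\<And>z. (\<lambda>j. let k = enumerate {k. 0 < measure M {x \<in> space M. N x = k}} j in
        cdf (distr (uniform_measure M {x \<in> space M. N x = k}) borel (\<lambda>x. X x / \<Lambda> (real k))) z)
        \<longlonglongrightarrow> cdf D z"
  shows "(\<lambda>n. cdf (distr (uniform_measure M {x \<in> space M. n \<le> N x}) borel (\<lambda>x. X x / \<Lambda> (real n))) z)
    \<longlonglongrightarrow> cdf D z"
proof -
  interpret prob_space M by fact
  interpret D: real_distribution D using D by (simp add: real_distribution_def real_distribution_axioms_def)
  define K where "K = {k. 0 < prob {x \<in> space M. N x = k}}"
  define \<phi> where "\<phi> = cdf D"
  define c where "c k w = cdf (distr (uniform_measure M {x \<in> space M. N x = k}) borel (\<lambda>x. X x / \<Lambda> (real k))) w" for k w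
  have conv_K: "\<exists>k0. \<forall>k\<ge>k0. k \<in> K \<longrightarrow> \<bar>c k w - \<phi> w\<bar> \<le> \<epsilon>" if "0 < \<epsilon>" for \<epsilon> w
  proof -
    have "(\<lambda>j. c (enumerate K j) w) \<longlonglongrightarrow> \<phi> w"
      using conv[of w] unfolding K_def \<phi>_def c_def Let_def .
    then have "eventually (\<lambda>j. dist (c (enumerate K j) w) (\<phi> w) < \<epsilon>) sequentially"
      using that by (rule tendstoD)
    then obtain j0 where j0: "\<And>j. j \<ge> j0 \<Longrightarrow> dist (c (enumerate K j) w) (\<phi> w) < \<epsilon>"
      by (auto simp: eventually_sequentially)
    show ?thesis
    proof (intro exI[of _ "enumerate K j0"] allI impI)
      fix k assume k: "enumerate K j0 \<le> k" "k \<in> K"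
      obtain j where j: "k = enumerate K j" using enumerate_Ex[OF _ k(2)] inf unfolding K_def by metis
      then have "j0 \<le> j" using k inf by (simp add: K_def)
      then show "\<bar>c k w - \<phi> w\<bar> \<le> \<epsilon>" using j0[of j] j by (simp add: dist_real_def)
    qed
  qed
  show ?thesis
  proof (rule LIMSEQ_I)
    fix r :: real assume "0 < r"
    define \<epsilon> where "\<epsilon> = r / 4"
    have \<epsilon>: "0 < \<epsilon>" using \<open>0 < r\<close> by (simp add: \<epsilon>_def)
    obtain d where d0: "0 < d" "\<forall>w. w \<noteq> z \<and> norm (w - z) < d \<longrightarrow> norm (\<phi> w - \<phi> z) < \<epsilon>"
      using LIM_D[OF D(3)[of z, unfolded isCont_def, folded \<phi>_def] \<epsilon>] by blast
    have d: "\<bar>\<phi> w - \<phi> z\<bar> < \<epsilon>" if "\<bar>w - z\<bar> < d" for w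
      using d0(2) that \<epsilon> by (cases "w = z") auto
    define \<eta> where "\<eta> = d / 2"
    have \<eta>: "0 < \<eta>" "\<bar>\<phi> (z + \<eta>) - \<phi> z\<bar> \<le> \<epsilon>" "\<bar>\<phi> (z - \<eta>) - \<phi> z\<bar> \<le> \<epsilon>"
      using d0(1) d[of "z + \<eta>"] d[of "z - \<eta>"] by (auto simp: \<eta>_def)
    \<comment> \<open>Chosen so that a relative error \<open>\<delta>\<close> in \<open>\<Lambda>\<close> moves \<open>z\<close> by at most \<open>\<eta>\<close>.\<close>
    define \<delta> where "\<delta> = \<eta> / (\<bar>z\<bar> + 1)"
    have \<delta>: "0 < \<delta>" "\<bar>z\<bar> * \<delta> \<le> \<eta>" using \<eta>(1) by (auto simp: \<delta>_def field_simps)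
    obtain A n1 where A: "A > 0" "\<And>n. n \<ge> n1 \<Longrightarrow> prob {x \<in> space M. A * n < N x} \<le> \<epsilon> * prob {x \<in> space M. n < N x}"
      using tails[OF \<epsilon>] by blast
    obtain x0 where x0: "\<And>x t. x \<ge> x0 \<Longrightarrow> 1 \<le> t \<Longrightarrow> t \<le> real A \<Longrightarrow>
        0 < \<Lambda> x \<and> 0 < \<Lambda> (t * x) \<and> \<bar>\<Lambda> x / \<Lambda> (t * x) - 1\<bar> \<le> \<delta>"
      by (rule slowly_varying_uniform[OF sv \<delta>(1), where A = "real A"]) (rule that)
    obtain n2 :: nat where n2: "x0 \<le> real n2" using real_arch_simple by blast
    obtain k1 where "\<forall>k\<ge>k1. k \<in> K \<longrightarrow> \<bar>c k (z + \<eta>) - \<phi> (z + \<eta>)\<bar> \<le> \<epsilon>"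
      using conv_K[OF \<epsilon>] ..
    note k1 = this[rule_format]
    obtain k2 where "\<forall>k\<ge>k2. k \<in> K \<longrightarrow> \<bar>c k (z - \<eta>) - \<phi> (z - \<eta>)\<bar> \<le> \<epsilon>"
      using conv_K[OF \<epsilon>] ..
    note k2 = this[rule_format]
    show "\<exists>n0. \<forall>n\<ge>n0. norm (cdf (distr (uniform_measure M {x \<in> space M. n \<le> N x}) borel
        (\<lambda>x. X x / \<Lambda> (real n))) z - cdf D z) < r"
    proof (intro exI[of _ "Max {1, n1, n2, k1, k2}"] allI impI)
      fix n assume "Max {1, n1, n2, k1, k2} \<le> n"
      then have n: "1 \<le> n" "n1 \<le> n" "n2 \<le> n" "k1 \<le> n" "k2 \<le> n" by auto
      define E where "E = {x \<in> space M. X x / \<Lambda> (real n) \<le> z}"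
      have E: "E \<in> events" unfolding E_def by measurable
      define B where "B = {x \<in> space M. n \<le> N x}"
      have B: "B \<in> events" unfolding B_def by measurable
      have mid: "\<bar>prob ({x \<in> space M. N x = k} \<inter> E) - prob {x \<in> space M. N x = k} * \<phi> z\<bar>
          \<le> (2 * \<epsilon>) * prob {x \<in> space M. N x = k}" if k: "n \<le> k" "k \<le> A * n" for k
      proof (cases "k \<in> K")
        case False
        then have 0: "prob {x \<in> space M. N x = k} = 0"
          using measure_nonneg[of M "{x \<in> space M. N x = k}"] by (simp add: K_def)
        have "prob ({x \<in> space M. N x = k} \<inter> E) \<le> prob {x \<in> space M. N x = k}"
          by (intro finite_measure_mono) auto
        then show ?thesis using 0 measure_nonneg[of M "{x \<in> space M. N x = k} \<inter> E"] by simp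
      next
        case True
        define Sk where "Sk = {x \<in> space M. N x = k}"
        have Sk: "Sk \<in> events" "0 < prob Sk" using True by (auto simp: Sk_def K_def)
        have ck: "prob (Sk \<inter> {x \<in> space M. X x / \<Lambda> (real k) \<le> w}) = prob Sk * c k w" for w
        proof -
          have "c k w = prob (Sk \<inter> {x \<in> space M. X x / \<Lambda> (real k) \<le> w}) / prob Sk"
            unfolding c_def Sk_def[symmetric]
            by (rule cdf_distr_uniform_measure[OF M _ Sk]) measurable
          then show ?thesis using Sk by simp
        qed
        define \<rho> where "\<rho> = \<Lambda> (real n) / \<Lambda> (real k)"
        have "x0 \<le> real n" using n2 n(3) by (meson of_nat_le_iff order.trans)
        moreover have "1 \<le> real k / real n" using k n by simp
        moreover have "real k / real n \<le> real A"
        proof -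
          have "real k \<le> real (A * n)" using k(2) by (simp only: of_nat_le_iff)
          then show ?thesis using n by (simp add: field_simps)
        qed
        moreover have "real k / real n * real n = real k" using n by simp
        ultimately have \<rho>: "0 < \<Lambda> (real n)" "0 < \<Lambda> (real k)" "\<bar>\<rho> - 1\<bar> \<le> \<delta>"
          using x0[of "real n" "real k / real n"] by (auto simp: \<rho>_def)
        have "\<bar>z * \<rho> - z\<bar> = \<bar>z\<bar> * \<bar>\<rho> - 1\<bar>" by (simp add: abs_mult[symmetric] algebra_simps)
        also have "\<dots> \<le> \<bar>z\<bar> * \<delta>" using \<rho> by (intro mult_left_mono) auto
        finally have z\<rho>: "z - \<eta> \<le> z * \<rho>" "z * \<rho> \<le> z + \<eta>" using \<delta>(2) by auto
        have E_iff: "X x / \<Lambda> (real n) \<le> z \<longleftrightarrow> X x / \<Lambda> (real k) \<le> z * \<rho>" for x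
          using \<rho> by (simp add: \<rho>_def field_simps)
        have "prob (Sk \<inter> E) \<le> prob (Sk \<inter> {x \<in> space M. X x / \<Lambda> (real k) \<le> z + \<eta>})"
          using z\<rho> Sk by (intro finite_measure_mono) (auto simp: E_def E_iff)
        also have "\<dots> \<le> prob Sk * (\<phi> z + 2 * \<epsilon>)"
          unfolding ck using Sk k1[of k] True k n \<eta> by (intro mult_left_mono) auto
        finally have 1: "prob (Sk \<inter> E) \<le> prob Sk * (\<phi> z + 2 * \<epsilon>)" .
        have "prob Sk * (\<phi> z - 2 * \<epsilon>) \<le> prob (Sk \<inter> {x \<in> space M. X x / \<Lambda> (real k) \<le> z - \<eta>})"
          unfolding ck using Sk k2[of k] True k n \<eta> by (intro mult_left_mono) auto
        also have "\<dots> \<le> prob (Sk \<inter> E)"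
          using z\<rho> Sk E by (intro finite_measure_mono) (auto simp: E_def E_iff)
        finally have 2: "prob Sk * (\<phi> z - 2 * \<epsilon>) \<le> prob (Sk \<inter> E)" .
        show ?thesis using 1 2 unfolding Sk_def[symmetric] abs_le_iff by (simp add: algebra_simps)
      qed
      have "prob {x \<in> space M. n < N x} \<le> prob B"
        unfolding B_def by (intro finite_measure_mono) auto
      then have "\<epsilon> * prob {x \<in> space M. n < N x} \<le> \<epsilon> * prob B" using \<epsilon> by simp
      then have tail: "prob {x \<in> space M. A * n < N x} \<le> \<epsilon> * prob B"
        using A(2)[OF n(2)] by linarith
      have bound: "\<bar>prob (B \<inter> E) - prob B * \<phi> z\<bar> \<le> (2 * \<epsilon> + \<epsilon>) * prob B"
        unfolding B_def
        using tail mid \<epsilon> A(1) D.cdf_nonneg[of z] D.cdf_bounded_prob[of z] E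
        by (intro mixture_bound[where m = "A * n"]) (auto simp: \<phi>_def B_def)
      have B0: "0 < prob B"
      proof -
        obtain k where "k \<in> K" "n \<le> k" using inf infinite_nat_iff_unbounded_le[of K] by (auto simp: K_def)
        moreover have "prob {x \<in> space M. N x = k} \<le> prob B" if "n \<le> k"
          using that B by (intro finite_measure_mono) (auto simp: B_def)
        ultimately show ?thesis by (auto simp: K_def)
      qed
      have "cdf (distr (uniform_measure M B) borel (\<lambda>x. X x / \<Lambda> (real n))) z = prob (B \<inter> E) / prob B"
        unfolding E_def using B B0 by (intro cdf_distr_uniform_measure[OF M]) auto
      then have "cdf (distr (uniform_measure M B) borel (\<lambda>x. X x / \<Lambda> (real n))) z - \<phi> z
          = (prob (B \<inter> E) - prob B * \<phi> z) / prob B"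
        using B0 by (simp add: field_simps)
      then have "\<bar>cdf (distr (uniform_measure M B) borel (\<lambda>x. X x / \<Lambda> (real n))) z - \<phi> z\<bar>
          = \<bar>prob (B \<inter> E) - prob B * \<phi> z\<bar> / prob B"
        using B0 by (simp add: abs_divide)
      also have "\<dots> \<le> 3 * \<epsilon>" using bound B0 by (simp add: field_simps)
      also have "\<dots> < r" using \<open>0 < r\<close> by (simp add: \<epsilon>_def)
      finally show "norm (cdf (distr (uniform_measure M {x \<in> space M. n \<le> N x}) borel
        (\<lambda>x. X x / \<Lambda> (real n))) z - cdf D z) < r"
        by (simp add: B_def \<phi>_def)
    qed
  qed
qed

theorem theorem5:
  fixes \<mu> :: "nat pmf" and L \<Lambda> :: "real \<Rightarrow> real"
  assumes "slowly_varying L"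
    and "(\<lambda>i. real i * pmf \<mu> i) sums 1"
    and "(\<lambda>n. measure_pmf.prob \<mu> {n..}) \<sim>[sequentially] (\<lambda>n. L (real n) / real n)"
    and "slowly_varying \<Lambda>"
    and "filterlim \<Lambda> at_top at_top"
    and "weak_conv_m
           (\<lambda>j. let n = enumerate (admissible_sizes \<mu>) j in
              distr (BGW_eq \<mu> n) borel (\<lambda>t. real (max_degree_height t) / \<Lambda> (real n)))
           (Exp_law 1)"
  shows "weak_conv_m
           (\<lambda>n. distr (BGW_ge \<mu> n) borel (\<lambda>t. real (max_degree_height t) / \<Lambda> (real n)))
           (Exp_law 1)"
proof -
  have ht: "halving_tail (\<lambda>n. measure_pmf.prob \<mu> {n<..})"
    using halving_tail_pmf[OF assms(1-3)] .
  interpret BGW: prob_space "BGW \<mu>" using prob_space_BGW[OF ht] .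
  have adm: "admissible_sizes \<mu> = {k. 0 < BGW.prob {t \<in> space (BGW \<mu>). num_vertices t = k}}"
    by (simp add: admissible_sizes_def BGW.emeasure_eq_measure)
  have pos: "0 < measure_pmf.prob \<mu> {n<..}" for n
    using halving_tail.b_pos[OF ht] .
  \<comment> \<open>Otherwise the offspring number is at least \<open>1\<close>, and it exceeds \<open>1\<close> with positive probability, against mean \<open>1\<close>.\<close>
  have "pmf \<mu> 0 > 0"
  proof (rule ccontr)
    assume "\<not> pmf \<mu> 0 > 0"
    then have "measure_pmf.prob \<mu> {0<..} = 1"
      using pmf_nonneg[of \<mu> 0] by (simp add: prob_greaterThan)
    moreover have "(\<Sum>n<2. measure_pmf.prob \<mu> {n<..}) \<le> 1"
      using halving_tail.b_sums[OF ht] sum_le_suminf[of "\<lambda>n. measure_pmf.prob \<mu> {n<..}" "{..<2}"]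
      by (auto simp: sums_iff)
    ultimately show False using pos[of 1] by (simp add: numeral_2_eq_2)
  qed
  moreover have "infinite (set_pmf \<mu>)"
  proof
    assume "finite (set_pmf \<mu>)"
    then obtain n where "\<forall>k\<in>set_pmf \<mu>. k \<le> n" using finite_nat_set_iff_bounded_le by auto
    then have "measure_pmf.prob \<mu> {n<..} = 0" by (auto simp: measure_pmf_zero_iff)
    then show False using pos[of n] by simp
  qed
  ultimately have inf: "infinite (admissible_sizes \<mu>)" by (rule infinite_admissible_sizes)
  have "(\<lambda>n. cdf (distr (uniform_measure (BGW \<mu>) {t \<in> space (BGW \<mu>). n \<le> num_vertices t}) borel
      (\<lambda>t. real (max_degree_height t) / \<Lambda> (real n))) z) \<longlonglongrightarrow> cdf (Exp_law 1) z" for z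
  proof (rule weak_conv_condition_ge)
    show "\<exists>A>0. \<exists>n0. \<forall>n\<ge>n0. BGW.prob {t \<in> space (BGW \<mu>). A * n < num_vertices t}
        \<le> \<epsilon> * BGW.prob {t \<in> space (BGW \<mu>). n < num_vertices t}" if \<epsilon>: "0 < \<epsilon>" for \<epsilon>
    proof -
      obtain A n0 where "A > 0" "\<And>n. n \<ge> n0 \<Longrightarrow>
        BGW.prob {t. A * n < num_vertices t} \<le> \<epsilon> * BGW.prob {t. n < num_vertices t}"
        by (rule BGW_size_tail_ratio[OF ht \<epsilon>]) (rule that)
      then show ?thesis by (intro exI[of _ A] exI[of _ n0] conjI allI impI) simp_all
    qed
    show "(\<lambda>j. let k = enumerate {k. 0 < BGW.prob {t \<in> space (BGW \<mu>). num_vertices t = k}} j in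
        cdf (distr (uniform_measure (BGW \<mu>) {t \<in> space (BGW \<mu>). num_vertices t = k}) borel
          (\<lambda>t. real (max_degree_height t) / \<Lambda> (real k))) w) \<longlonglongrightarrow> cdf (Exp_law 1) w" for w
      using assms(6) isCont_cdf_Exp_law[of w]
      unfolding adm[symmetric] weak_conv_m_def weak_conv_def BGW_eq_def Let_def by simp
    show "num_vertices \<in> measurable (BGW \<mu>) (count_space UNIV)"
      "(\<lambda>t. real (max_degree_height t)) \<in> borel_measurable (BGW \<mu>)"
      by (simp_all add: measurable_def)
    show "infinite {k. 0 < BGW.prob {t \<in> space (BGW \<mu>). num_vertices t = k}}"
      using inf unfolding adm .
    show "sets (Exp_law 1) = sets borel" by (simp add: Exp_law_def)
  qed (fact BGW.prob_space_axioms prob_space_Exp_law isCont_cdf_Exp_law assms(4))+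
  then show ?thesis
    unfolding weak_conv_m_def weak_conv_def BGW_ge_def by simp
qed

end
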